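(* Let $n\ge2$ and let $\gamma_0\in\dot C^\infty(\mathbb{R};\mathbb{R}^n)$ be the profile curve of either a non-scaling or a shrinking soliton to the free elastic flow $\partial_t\gamma=-\nabla_s^2\kappa-\frac12|\kappa|^2\kappa$. Suppose that $B[\gamma_0]<\infty$. Then $\gamma_0$ is a straight line.
   Context: For an immersed curve $\gamma$ in $\mathbb{R}^n$ (or each curve $\gamma(t,\cdot)$ of a family), $\partial_s=|\partial_x\gamma|^{-1}\partial_x$, $ds=|\partial_x\gamma|\,dx$, $\kappa=\partial_s^2\gamma$, and $\nabla_sf=\partial_sf-\langle\partial_sf,\partial_s\gamma\rangle\partial_s\gamma$. The bending energy is $B[\gamma]=\frac12\int_\gamma|\kappa|^2\,ds$. $\mathbb{N}_0=\{0,1,2,\dots\}$. $\dot C^\infty(\mathbb{R};\mathbb{R}^n)$ is the space of smooth maps $u:\mathbb{R}\to\mathbb{R}^n$ all of whose derivatives of order $\ge1$ are bounded on $\mathbb{R}$. $C^\infty([0,T']\times\mathbb{R})$ denotes the maps $u$ all of whose derivatives $\partial_t^\alpha\partial_x^\beta u$, $\alpha,\beta\in\mathbb{N}_0$, are bounded on $[0,T']\times\mathbb{R}$. Maximal existence time: for an initial datum $\gamma_0\in\dot C^\infty(\mathbb{R};\mathbb{R}^n)$ with $\inf_{\mathbb{R}}|\partial_x\gamma_0|>0$, $T\in(0,\infty]$ is the supremum of all $T'\in(0,\infty)$ such that there is a unique smooth solution $\gamma:[0,T']\times\mathbb{R}\to\mathbb{R}^n$ of the flow starting from $\gamma_0$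 with $\gamma-\gamma_0\in C^\infty([0,T']\times\mathbb{R})$ and $\inf_{[0,T']\times\mathbb{R}}|\partial_x\gamma|>0$. Solitons: let $\gamma:[0,T)\times\mathbb{R}\to\mathbb{R}^n$ be a solution to a flow with maximal existence time $T\in(0,\infty]$ and initial datum $\gamma_0$ (so $\inf_{\mathbb{R}}|\partial_x\gamma_0|>0$, as required in the definition of the maximal existence time). It is a shrinking soliton if there is a decreasing function $\alpha:[0,T)\to(0,\infty)$ with $\alpha(0)=1$ and $\lim_{t\to T}\alpha(t)=0$ such that $\gamma(t)$ is isometric to $\alpha(t)\gamma_0$ for all $t\in[0,T)$. It is a non-scaling soliton if $T=\infty$ and $\gamma(t)$ is isometric to $\gamma_0$ for all $t\ge0$. Here two curves are isometric if, up to reparametrization, one is the image of the other under an isometry of $\mathbb{R}^n$. In all cases $\gamma_0$ is called the profile curve of the soliton. *)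

theory Defs
  imports "HOL-Analysis.Analysis"
begin

section \<open>Smooth maps\<close>

definition D :: "(real \<Rightarrow> 'a::real_normed_vector) \<Rightarrow> real \<Rightarrow> 'a" where
  "D f x = vector_derivative f (at x)"

definition smooth :: "(real \<Rightarrow> 'a::real_normed_vector) \<Rightarrow> bool" where
  "smooth f \<longleftrightarrow> (\<forall>k x. (D ^^ k) f differentiable (at x))"

definition Cdot_infty :: "(real \<Rightarrow> 'a::real_normed_vector) set" where
  "Cdot_infty = {u. smooth u \<and> (\<forall>k\<ge>1. bounded (range ((D ^^ k) u)))}"

text \<open>
  A map on \<open>[0,T'] \<times> \<real>\<close> is a curried function \<open>u t x\<close>. Time derivatives are taken within
  \<open>[0,T']\<close>, hence are one-sided at the end points, and no value of \<open>u\<close> outside the slab matters.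
\<close>

definition Dx :: "(real \<Rightarrow> real \<Rightarrow> 'a::real_normed_vector) \<Rightarrow> real \<Rightarrow> real \<Rightarrow> 'a" where
  "Dx u t x = D (u t) x"

definition Dt :: "real \<Rightarrow> (real \<Rightarrow> real \<Rightarrow> 'a::real_normed_vector) \<Rightarrow> real \<Rightarrow> real \<Rightarrow> 'a" where
  "Dt T' u t x = vector_derivative (\<lambda>\<tau>. u \<tau> x) (at t within {0..T'})"

definition partial :: "real \<Rightarrow> nat \<Rightarrow> nat \<Rightarrow> (real \<Rightarrow> real \<Rightarrow> 'a::real_normed_vector)
    \<Rightarrow> real \<Rightarrow> real \<Rightarrow> 'a" where
  "partial T' a b u = (Dt T' ^^ a) ((Dx ^^ b) u)"

text \<open>
  Smoothness up to the boundary of the slab: all \<open>\<partial>\<^sub>t\<^sup>a \<partial>\<^sub>x\<^sup>b u\<close> exist, can be differentiated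
  further in either variable, and are jointly continuous; the order of differentiation is then
  immaterial.
\<close>

definition smooth_slab :: "real \<Rightarrow> (real \<Rightarrow> real \<Rightarrow> 'a::real_normed_vector) \<Rightarrow> bool" where
  "smooth_slab T' u \<longleftrightarrow> (\<forall>a b.
      continuous_on ({0..T'} \<times> UNIV) (\<lambda>(t, x). partial T' a b u t x) \<and>
      (\<forall>t\<in>{0..T'}. \<forall>x.
         (\<lambda>\<tau>. partial T' a b u \<tau> x) differentiable (at t within {0..T'}) \<and>
         partial T' a b u t differentiable (at x)))"

definition C_infty_slab :: "real \<Rightarrow> (real \<Rightarrow> real \<Rightarrow> 'a::real_normed_vector) set" where
  "C_infty_slab T' = {u. smooth_slab T' u \<and>
      (\<forall>a b. bounded ((\<lambda>(t, x). partial T' a b u t x) ` ({0..T'} \<times> UNIV)))}"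


section \<open>Geometry of immersed curves\<close>

definition ds :: "(real \<Rightarrow> 'a::real_inner) \<Rightarrow> (real \<Rightarrow> 'a) \<Rightarrow> real \<Rightarrow> 'a" where
  "ds \<gamma> f x = inverse (norm (D \<gamma> x)) *\<^sub>R D f x"

definition curvature :: "(real \<Rightarrow> 'a::real_inner) \<Rightarrow> real \<Rightarrow> 'a" where
  "curvature \<gamma> = ds \<gamma> (ds \<gamma> \<gamma>)"

definition nabla_s :: "(real \<Rightarrow> 'a::real_inner) \<Rightarrow> (real \<Rightarrow> 'a) \<Rightarrow> real \<Rightarrow> 'a" where
  "nabla_s \<gamma> f x = ds \<gamma> f x - (ds \<gamma> f x \<bullet> ds \<gamma> \<gamma> x) *\<^sub>R ds \<gamma> \<gamma> x"

definition bending_energy :: "(real \<Rightarrow> 'a::real_inner) \<Rightarrow> ennreal" where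
  "bending_energy \<gamma> =
     1 / 2 * (\<integral>\<^sup>+ x. ennreal ((norm (curvature \<gamma> x))\<^sup>2 * norm (D \<gamma> x)) \<partial>lborel)"

text \<open>Orientation-reversing reparametrizations are allowed.\<close>

definition reparametrization :: "(real \<Rightarrow> real) \<Rightarrow> bool" where
  "reparametrization \<phi> \<longleftrightarrow> smooth \<phi> \<and> bij \<phi> \<and> (\<forall>x. D \<phi> x \<noteq> 0)"

text \<open>
  Isometries of a Euclidean space are bijective and the inverse of a reparametrization is again
  one, so this relation is symmetric.
\<close>

definition isometric_curves :: "(real \<Rightarrow> 'a::euclidean_space) \<Rightarrow> (real \<Rightarrow> 'a) \<Rightarrow> bool" where
  "isometric_curves \<gamma> \<eta> \<longleftrightarrow> (\<exists>F \<phi>.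
      (\<forall>p q. dist (F p) (F q) = dist p q) \<and> reparametrization \<phi> \<and> \<gamma> = F \<circ> \<eta> \<circ> \<phi>)"

text \<open>A straight line is a curve which is, up to reparametrization, \<open>s \<mapsto> p + s v\<close> with \<open>v \<noteq> 0\<close>.\<close>

definition straight_line :: "(real \<Rightarrow> 'a::euclidean_space) \<Rightarrow> bool" where
  "straight_line \<gamma> \<longleftrightarrow> (\<exists>p v \<phi>.
      v \<noteq> 0 \<and> reparametrization \<phi> \<and> \<gamma> = (\<lambda>s. p + s *\<^sub>R v) \<circ> \<phi>)"


section \<open>Flows and solitons\<close>

text \<open>A flow \<open>\<partial>\<^sub>t \<gamma> = V[\<gamma>(t,\<cdot>)]\<close> is given by its velocity \<open>V\<close>, an operator on curves.\<close>

type_synonym 'a velocity = "(real \<Rightarrow> 'a) \<Rightarrow> real \<Rightarrow> 'a"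

definition free_elastic_flow :: "'a::real_inner velocity" where
  "free_elastic_flow \<gamma> x =
     - nabla_s \<gamma> (nabla_s \<gamma> (curvature \<gamma>)) x
     - (1 / 2 * (norm (curvature \<gamma> x))\<^sup>2) *\<^sub>R curvature \<gamma> x"

definition flow_solution ::
    "'a::euclidean_space velocity \<Rightarrow> real \<Rightarrow> (real \<Rightarrow> 'a) \<Rightarrow> (real \<Rightarrow> real \<Rightarrow> 'a) \<Rightarrow> bool" where
  "flow_solution V T' \<gamma>0 \<gamma> \<longleftrightarrow>
     smooth_slab T' \<gamma> \<and>
     (\<forall>x. \<gamma> 0 x = \<gamma>0 x) \<and>
     (\<forall>t\<in>{0..T'}. \<forall>x. Dt T' \<gamma> t x = V (\<gamma> t) x) \<and>
     (\<lambda>t x. \<gamma> t x - \<gamma>0 x) \<in> C_infty_slab T' \<and>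
     0 < (INF (t, x)\<in>{0..T'} \<times> UNIV. norm (Dx \<gamma> t x))"

definition uniquely_solvable ::
    "'a::euclidean_space velocity \<Rightarrow> real \<Rightarrow> (real \<Rightarrow> 'a) \<Rightarrow> bool" where
  "uniquely_solvable V T' \<gamma>0 \<longleftrightarrow>
     (\<exists>\<gamma>. flow_solution V T' \<gamma>0 \<gamma>) \<and>
     (\<forall>\<gamma> \<eta>. flow_solution V T' \<gamma>0 \<gamma> \<longrightarrow> flow_solution V T' \<gamma>0 \<eta> \<longrightarrow>
        (\<forall>t\<in>{0..T'}. \<forall>x. \<gamma> t x = \<eta> t x))"

definition maximal_existence_time ::
    "'a::euclidean_space velocity \<Rightarrow> (real \<Rightarrow> 'a) \<Rightarrow> ereal" where
  "maximal_existence_time V \<gamma>0 = Sup {ereal T' |T'. 0 < T' \<and> uniquely_solvable V T' \<gamma>0}"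

text \<open>
  If no \<open>T'\<close> is admissible, the supremum above is \<open>- \<infinity>\<close>; the condition \<open>0 < T\<close> excludes this.
\<close>

definition maximal_solution ::
    "'a::euclidean_space velocity \<Rightarrow> ereal \<Rightarrow> (real \<Rightarrow> 'a) \<Rightarrow> (real \<Rightarrow> real \<Rightarrow> 'a) \<Rightarrow> bool" where
  "maximal_solution V T \<gamma>0 \<gamma> \<longleftrightarrow>
     \<gamma>0 \<in> Cdot_infty \<and> 0 < (INF x. norm (D \<gamma>0 x)) \<and>
     0 < T \<and> T = maximal_existence_time V \<gamma>0 \<and>
     (\<forall>T'>0. ereal T' < T \<longrightarrow> flow_solution V T' \<gamma>0 \<gamma>)"

text \<open>Monotonicity of \<open>\<alpha>\<close> is understood in the weak sense.\<close>

definition shrinking_soliton ::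
    "'a::euclidean_space velocity \<Rightarrow> ereal \<Rightarrow> (real \<Rightarrow> 'a) \<Rightarrow> (real \<Rightarrow> real \<Rightarrow> 'a) \<Rightarrow> bool" where
  "shrinking_soliton V T \<gamma>0 \<gamma> \<longleftrightarrow>
     maximal_solution V T \<gamma>0 \<gamma> \<and>
     (\<exists>\<alpha>::real \<Rightarrow> real.
        (\<forall>t\<ge>0. ereal t < T \<longrightarrow> 0 < \<alpha> t) \<and>
        antimono_on {t. 0 \<le> t \<and> ereal t < T} \<alpha> \<and>
        \<alpha> 0 = 1 \<and>
        ((\<alpha> \<circ> real_of_ereal) \<longlongrightarrow> 0) (at_left T) \<and>
        (\<forall>t\<ge>0. ereal t < T \<longrightarrow> isometric_curves (\<gamma> t) (\<lambda>x. \<alpha> t *\<^sub>R \<gamma>0 x)))"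

definition non_scaling_soliton ::
    "'a::euclidean_space velocity \<Rightarrow> (real \<Rightarrow> 'a) \<Rightarrow> (real \<Rightarrow> real \<Rightarrow> 'a) \<Rightarrow> bool" where
  "non_scaling_soliton V \<gamma>0 \<gamma> \<longleftrightarrow>
     maximal_solution V \<infinity> \<gamma>0 \<gamma> \<and> (\<forall>t\<ge>0. isometric_curves (\<gamma> t) \<gamma>0)"

end

theory Submission
  imports Defs
begin

text \<open>
  The bending energy decreases along the flow, and for a soliton this leaves no room: at time \<open>t\<close>
  a shrinking soliton has \<open>1 / \<alpha> t\<close> times its initial energy, which for \<open>\<alpha> t < 1\<close> forces that energy to be zero, while a non-scaling
  soliton keeps its energy, so nothing is dissipated and its profile is a free elastica.

  The only difficulty is that the curve is not compact. Nothing is known about the decay of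
  \<open>\<kappa>\<close> and its derivatives at infinity, so the energy identity cannot simply be integrated over the
  line. It does hold locally: with \<open>e = \<bar>\<kappa>\<bar>\<^sup>2 g / 2\<close>, \<open>g = \<bar>\<gamma>\<^sub>x\<bar>\<close>, and \<open>V\<close> the velocity,
  \<open>e\<^sub>t = P\<^sub>x - g \<bar>V\<bar>\<^sup>2\<close> for an explicit flux \<open>P\<close> (\<open>energy_conservation_law\<close>). This law is integrated
  against a weight \<open>\<eta>\<close> with \<open>\<bar>\<eta>'\<bar>, \<bar>\<eta>''\<bar> \<le> \<delta> \<eta>\<close>. The errors produced by \<open>\<eta>\<close> contain \<open>\<nabla>\<^sub>s \<kappa>\<close>,
  which the energy does not control, but \<open>\<eta> g \<bar>\<nabla>\<^sub>s \<kappa>\<bar>\<^sup>2\<close> is, up to a divergence, bounded by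
  \<open>\<bar>V\<bar>\<^sup>2\<close> and \<open>\<bar>\<kappa>\<bar>\<^sup>2\<close>. A small multiple of \<open>\<eta> \<langle>\<kappa>, \<nabla>\<^sub>s \<kappa>\<rangle>\<close> is therefore added to the flux, and all errors
  are absorbed by half the dissipation and \<open>C \<delta> \<eta> e\<close>, pointwise (\<open>flux_inequality\<close>).
  Gronwall's inequality on \<open>[-R, R]\<close>, with Gaussian weights for which \<open>\<delta> \<rightarrow> 0\<close> while \<open>R \<rightarrow> \<infinity>\<close> and
  the boundary terms vanish, gives \<open>energy_inequality\<close>.

  It remains to see that a free elastica of finite energy is a line. Along it
  \<open>c = \<bar>\<nabla>\<^sub>s \<kappa>\<bar>\<^sup>2 + \<bar>\<kappa>\<bar>\<^sup>4 / 4\<close> is constant, and \<open>\<partial>\<^sub>s \<langle>\<kappa>, \<nabla>\<^sub>s \<kappa>\<rangle> = c - 3/4 \<bar>\<kappa>\<bar>\<^sup>4\<close>. Since \<open>\<kappa>\<close> is bounded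
  and square integrable, \<open>c > 0\<close> would make the bounded quantity \<open>\<langle>\<kappa>, \<nabla>\<^sub>s \<kappa>\<rangle>\<close> grow linearly.
  Hence \<open>\<kappa> = 0\<close> (\<open>free_elastica_flat\<close>).
\<close>

section \<open>Differentiating the unit tangent\<close>

definition normal_part :: "'a::real_inner \<Rightarrow> 'a \<Rightarrow> 'a" where
  "normal_part a v = v - (v \<bullet> sgn a) *\<^sub>R sgn a"

text \<open>
  The derivative of \<open>sgn\<close> at \<open>a\<close> in direction \<open>v\<close>. With \<open>a = \<gamma>\<^sub>x\<close> and \<open>T = sgn a\<close> it gives
  \<open>T\<^sub>x = g \<kappa>\<close> for \<open>v = \<gamma>\<^sub>x\<^sub>x\<close> and \<open>T\<^sub>t = \<nabla>\<^sub>s V\<close> for \<open>v = \<gamma>\<^sub>x\<^sub>t = V\<^sub>x\<close>.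
\<close>

definition dsgn :: "'a::real_inner \<Rightarrow> 'a \<Rightarrow> 'a" where
  "dsgn a v = inverse (norm a) *\<^sub>R normal_part a v"

text \<open>
  The derivative of \<open>dsgn a v\<close> when \<open>a\<close> moves with velocity \<open>p\<close> and \<open>v\<close> with velocity \<open>q\<close>.
\<close>

definition ddsgn :: "'a::real_inner \<Rightarrow> 'a \<Rightarrow> 'a \<Rightarrow> 'a \<Rightarrow> 'a" where
  "ddsgn a v p q = inverse (norm a) *\<^sub>R
     (q - (q \<bullet> sgn a) *\<^sub>R sgn a - (v \<bullet> dsgn a p) *\<^sub>R sgn a - (v \<bullet> sgn a) *\<^sub>R dsgn a p)
     - ((sgn a \<bullet> p) / (norm a)\<^sup>2) *\<^sub>R normal_part a v"

lemma sgn_unit: "a \<noteq> 0 \<Longrightarrow> sgn a \<bullet> sgn a = 1" for a :: "'a::real_inner"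
  by (simp add: dot_square_norm norm_sgn)

lemma normal_part_orthogonal:
  assumes "a \<noteq> 0" shows "normal_part a v \<bullet> sgn a = 0"
  using sgn_unit[OF assms] by (simp add: normal_part_def inner_diff_left)

lemma dsgn_orthogonal:
  assumes "a \<noteq> 0" shows "dsgn a v \<bullet> sgn a = 0"
  using normal_part_orthogonal[OF assms] by (simp add: dsgn_def)

lemma inner_normal_part:
  assumes "w \<bullet> sgn a = 0" shows "normal_part a v \<bullet> w = v \<bullet> w"
  using assms by (simp add: normal_part_def inner_diff_left inner_commute[of w])

lemma dsgn_decomposition:
  assumes "a \<noteq> 0" shows "v = (v \<bullet> sgn a) *\<^sub>R sgn a + norm a *\<^sub>R dsgn a v"
  using assms by (simp add: dsgn_def normal_part_def)

text \<open>
  The mixed derivatives of \<open>sgn\<close> agree. For \<open>v = \<gamma>\<^sub>x\<^sub>x\<close>, \<open>p = V\<^sub>x\<close>, \<open>q = V\<^sub>x\<^sub>x\<close> this is \<open>T\<^sub>x\<^sub>t = T\<^sub>t\<^sub>x\<close>, which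
  replaces the commutator formula for \<open>\<partial>\<^sub>t\<close> and \<open>\<partial>\<^sub>s\<close>.
\<close>

lemma ddsgn_symmetric: "ddsgn a v p q = ddsgn a p v q"
proof (cases "a = 0")
  case True
  then show ?thesis by (simp add: ddsgn_def)
next
  case False
  define s where "s = sgn a"
  define g where "g = norm a"
  have s: "s \<bullet> s = 1" "g \<noteq> 0" using sgn_unit[OF False] False by (auto simp: s_def g_def)
  have eq: "v \<bullet> dsgn a p = p \<bullet> dsgn a v"
    by (simp add: dsgn_def normal_part_def inner_diff_right inner_commute)
  show ?thesis
    unfolding ddsgn_def eq unfolding dsgn_def normal_part_def s_def[symmetric] g_def[symmetric]
    using s(2)
    by (simp add: algebra_simps power2_eq_square divide_inverse inner_commute)
qed

lemma has_real_derivative_norm: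
  fixes u :: "real \<Rightarrow> 'a::real_inner"
  assumes "(u has_vector_derivative p) (at x within S)" "u x \<noteq> 0"
  shows "((\<lambda>y. norm (u y)) has_real_derivative sgn (u x) \<bullet> p) (at x within S)"
proof -
  have "((\<lambda>y. norm (u y)) has_derivative (\<lambda>h. (h *\<^sub>R p) \<bullet> sgn (u x))) (at x within S)"
    by (rule has_derivative_compose[OF assms(1)[unfolded has_vector_derivative_def]
          has_derivative_norm[OF assms(2)]])
  then show ?thesis
    unfolding has_field_derivative_def
    by (simp add: inner_commute mult_commute_abs)
qed

lemma has_vector_derivative_sgn:
  fixes u :: "real \<Rightarrow> 'a::real_inner"
  assumes "(u has_vector_derivative p) (at x within S)" "u x \<noteq> 0"
  shows "((\<lambda>y. sgn (u y)) has_vector_derivative dsgn (u x) p) (at x within S)"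
proof -
  have "((\<lambda>y. inverse (norm (u y)) *\<^sub>R u y) has_vector_derivative
       (inverse (norm (u x)) *\<^sub>R p + (- (inverse (norm (u x)) * (sgn (u x) \<bullet> p) * inverse (norm (u x)))) *\<^sub>R u x))
       (at x within S)"
    using assms by (intro has_vector_derivative_scaleR DERIV_inverse' has_real_derivative_norm) auto
  moreover have "inverse (norm (u x)) *\<^sub>R p + (- (inverse (norm (u x)) * (sgn (u x) \<bullet> p) * inverse (norm (u x)))) *\<^sub>R u x
    = dsgn (u x) p"
    by (simp add: dsgn_def normal_part_def sgn_div_norm algebra_simps inner_commute)
  ultimately show ?thesis by (simp add: sgn_div_norm)
qed

lemma has_vector_derivative_dsgn:
  fixes u v :: "real \<Rightarrow> 'a::real_inner"
  assumes u: "(u has_vector_derivative p) (at x within S)" "u x \<noteq> 0"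
    and v: "(v has_vector_derivative q) (at x within S)"
  shows "((\<lambda>y. dsgn (u y) (v y)) has_vector_derivative ddsgn (u x) (v x) p q) (at x within S)"
proof -
  note s = has_vector_derivative_sgn[OF u]
  have i: "((\<lambda>y. v y \<bullet> sgn (u y)) has_real_derivative q \<bullet> sgn (u x) + v x \<bullet> dsgn (u x) p) (at x within S)"
    using bounded_bilinear.has_vector_derivative[OF bounded_bilinear_inner v s]
    by (simp add: has_real_derivative_iff_has_vector_derivative add.commute)
  have n: "((\<lambda>y. normal_part (u y) (v y)) has_vector_derivative
      q - ((v x \<bullet> sgn (u x)) *\<^sub>R dsgn (u x) p + (q \<bullet> sgn (u x) + v x \<bullet> dsgn (u x) p) *\<^sub>R sgn (u x)))
      (at x within S)"
    unfolding normal_part_def by (intro has_vector_derivative_diff has_vector_derivative_scaleR v s i)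
  have "((\<lambda>y. dsgn (u y) (v y)) has_vector_derivative
      inverse (norm (u x)) *\<^sub>R (q - ((v x \<bullet> sgn (u x)) *\<^sub>R dsgn (u x) p
         + (q \<bullet> sgn (u x) + v x \<bullet> dsgn (u x) p) *\<^sub>R sgn (u x)))
      + (- (inverse (norm (u x)) * (sgn (u x) \<bullet> p) * inverse (norm (u x)))) *\<^sub>R normal_part (u x) (v x))
      (at x within S)"
    unfolding dsgn_def[of "u _" "v _"]
    by (intro has_vector_derivative_scaleR DERIV_inverse' has_real_derivative_norm n u)
       (simp add: u(2))
  then show ?thesis
    by (rule has_vector_derivative_eq_rhs)
       (simp add: ddsgn_def algebra_simps power2_eq_square divide_inverse)
qed

lemma has_real_derivative_inner:
  fixes u v :: "real \<Rightarrow> 'a::real_inner"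
  assumes "(u has_vector_derivative p) (at x within S)" "(v has_vector_derivative q) (at x within S)"
  shows "((\<lambda>y. u y \<bullet> v y) has_real_derivative p \<bullet> v x + u x \<bullet> q) (at x within S)"
  using bounded_bilinear.has_vector_derivative[OF bounded_bilinear_inner assms]
  by (simp add: has_real_derivative_iff_has_vector_derivative add.commute)

section \<open>Geometry along an immersed curve\<close>

lemma smooth_has_vector_derivative:
  assumes "smooth f"
  shows "((D ^^ k) f has_vector_derivative (D ^^ Suc k) f x) (at x)"
  using assms by (simp add: smooth_def D_def[abs_def] vector_derivative_works[symmetric])

lemma D_eqI: "(f has_vector_derivative f') (at x) \<Longrightarrow> D f x = f'"
  by (simp add: D_def vector_derivative_at)

lemma smooth_differentiable: "smooth f \<Longrightarrow> (D ^^ k) f differentiable (at x)"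
  by (simp add: smooth_def)

locale immersed_curve =
  fixes \<gamma> :: "real \<Rightarrow> 'a::euclidean_space"
  assumes smooth: "smooth \<gamma>" and immersed: "\<And>x. D \<gamma> x \<noteq> 0"
begin

abbreviation "u1 \<equiv> D \<gamma>"
abbreviation "u2 \<equiv> D (D \<gamma>)"
abbreviation "u3 \<equiv> D (D (D \<gamma>))"
abbreviation "g x \<equiv> norm (D \<gamma> x)"
abbreviation "T x \<equiv> sgn (D \<gamma> x)"
abbreviation "\<kappa> \<equiv> curvature \<gamma>"
abbreviation "N \<equiv> nabla_s \<gamma> (curvature \<gamma>)"
abbreviation "N2 \<equiv> nabla_s \<gamma> (nabla_s \<gamma> (curvature \<gamma>))"
abbreviation "V \<equiv> free_elastic_flow \<gamma>"

lemma speed_pos: "g x > 0" using immersed by simp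

lemma u1_deriv: "(u1 has_vector_derivative u2 x) (at x)"
  using smooth_has_vector_derivative[OF smooth, of 1] by simp
lemma u2_deriv: "(u2 has_vector_derivative u3 x) (at x)"
  using smooth_has_vector_derivative[OF smooth, of 2] by (simp add: numeral_2_eq_2)
lemma u3_differentiable: "u3 differentiable (at x)"
  using smooth_differentiable[OF smooth, of 3] by (simp add: numeral_3_eq_3)

lemma ds_conv: "D f x = g x *\<^sub>R ds \<gamma> f x"
  using immersed[of x] by (simp add: ds_def)

lemma ds_\<gamma>: "ds \<gamma> \<gamma> = T"
  by (simp add: fun_eq_iff ds_def sgn_div_norm)

lemma T_unit: "T x \<bullet> T x = 1" by (rule sgn_unit[OF immersed])

lemma T_deriv: "(T has_vector_derivative dsgn (u1 x) (u2 x)) (at x)"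
  by (rule has_vector_derivative_sgn[OF u1_deriv immersed])

lemma curvature_eq: "\<kappa> x = inverse (g x) *\<^sub>R dsgn (u1 x) (u2 x)"
  unfolding curvature_def ds_\<gamma> unfolding ds_def D_eqI[OF T_deriv] ..

lemma T_deriv': "(T has_vector_derivative g x *\<^sub>R \<kappa> x) (at x)"
  using T_deriv immersed by (simp add: curvature_eq)

lemma \<kappa>_T: "\<kappa> x \<bullet> T x = 0"
  by (simp add: curvature_eq dsgn_orthogonal[OF immersed])

text \<open>
  The derivative of \<open>\<kappa>\<close> written out in \<open>\<gamma>\<^sub>x, \<gamma>\<^sub>x\<^sub>x, \<gamma>\<^sub>x\<^sub>x\<^sub>x\<close>. The explicit form is what makes
  \<open>\<nabla>\<^sub>s \<kappa>\<close> visibly differentiable and, later, uniformly bounded.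
\<close>

definition "\<kappa>x x = inverse (g x) *\<^sub>R ddsgn (u1 x) (u2 x) (u2 x) (u3 x)
     - (inverse (g x) * (T x \<bullet> u2 x) * inverse (g x)) *\<^sub>R dsgn (u1 x) (u2 x)"

lemma \<kappa>_deriv0: "(\<kappa> has_vector_derivative \<kappa>x x) (at x)"
proof -
  have "((\<lambda>x. inverse (g x) *\<^sub>R dsgn (u1 x) (u2 x)) has_vector_derivative 
     inverse (g x) *\<^sub>R ddsgn (u1 x) (u2 x) (u2 x) (u3 x)
     + (- (inverse (g x) * (T x \<bullet> u2 x) * inverse (g x))) *\<^sub>R dsgn (u1 x) (u2 x)) (at x)"
    by (intro has_vector_derivative_scaleR DERIV_inverse' has_real_derivative_norm
         has_vector_derivative_dsgn u1_deriv u2_deriv immersed) (use immersed in auto)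
  then show ?thesis by (simp add: curvature_eq[abs_def] \<kappa>x_def)
qed

lemma N_eq: "N x = dsgn (u1 x) (\<kappa>x x)"
  unfolding nabla_s_def ds_\<gamma>
  by (simp add: ds_def D_eqI[OF \<kappa>_deriv0] dsgn_def normal_part_def algebra_simps)

lemma nabla_T: "nabla_s \<gamma> f x \<bullet> T x = 0"
  by (simp add: nabla_s_def ds_\<gamma> inner_diff_left T_unit)

text \<open>
  For a normal field \<open>f\<close>, differentiating \<open>\<langle>f, T\<rangle> = 0\<close> shows that the tangential part of
  \<open>\<partial>\<^sub>s f\<close> is \<open>- \<langle>f, \<kappa>\<rangle> T\<close>.
\<close>

lemma ds_nabla:
  assumes f: "f differentiable (at x)" and "\<And>x. f x \<bullet> T x = 0"
  shows "(f has_vector_derivative g x *\<^sub>R (nabla_s \<gamma> f x - (f x \<bullet> \<kappa> x) *\<^sub>R T x)) (at x)"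
proof -
  have d: "(f has_vector_derivative g x *\<^sub>R ds \<gamma> f x) (at x)"
    using f by (metis ds_conv D_def vector_derivative_works)
  have "((\<lambda>x. f x \<bullet> T x) has_real_derivative (g x *\<^sub>R ds \<gamma> f x) \<bullet> T x + f x \<bullet> (g x *\<^sub>R \<kappa> x)) (at x)"
    by (rule has_real_derivative_inner[OF d T_deriv'])
  moreover have "((\<lambda>x. f x \<bullet> T x) has_real_derivative 0) (at x)"
    by (simp add: assms(2))
  ultimately have "(g x *\<^sub>R ds \<gamma> f x) \<bullet> T x + f x \<bullet> (g x *\<^sub>R \<kappa> x) = 0"
    using DERIV_unique by blast
  then have "g x * (ds \<gamma> f x \<bullet> T x + f x \<bullet> \<kappa> x) = 0" by (simp add: algebra_simps)
  then have "ds \<gamma> f x \<bullet> T x = - (f x \<bullet> \<kappa> x)" using immersed[of x] by simp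
  then have "ds \<gamma> f x = nabla_s \<gamma> f x - (f x \<bullet> \<kappa> x) *\<^sub>R T x"
    by (simp add: nabla_s_def ds_\<gamma>)
  with d show ?thesis by simp
qed

lemma \<kappa>_deriv: "(\<kappa> has_vector_derivative g x *\<^sub>R (N x - (\<kappa> x \<bullet> \<kappa> x) *\<^sub>R T x)) (at x)"
  by (rule ds_nabla[OF differentiableI_vector[OF \<kappa>_deriv0] \<kappa>_T])

lemma N_differentiable: "N differentiable (at x)"
proof -
  have "\<kappa>x differentiable (at x)"
  proof -
    have t: "T differentiable (at x)" "u1 differentiable (at x)" "u2 differentiable (at x)"
      using T_deriv u1_deriv u2_deriv by (auto intro: differentiableI_vector)
    have g: "(\<lambda>x. norm (u1 x)) differentiable (at x)"
      by (rule differentiableI_vector[OF has_real_derivative_norm[OF u1_deriv immersed,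
            unfolded has_real_derivative_iff_has_vector_derivative]])
    show ?thesis
      unfolding \<kappa>x_def[abs_def] ddsgn_def dsgn_def normal_part_def divide_inverse
      using immersed
      by (intro differentiable_diff differentiable_scaleR differentiable_mult differentiable_inverse
          differentiable_inner differentiable_power t g u3_differentiable) auto
  qed
  then have "(\<lambda>x. dsgn (u1 x) (\<kappa>x x)) differentiable (at x)"
    unfolding vector_derivative_works
    using differentiableI_vector[OF has_vector_derivative_dsgn[OF u1_deriv immersed]]
      vector_derivative_works by blast
  then show ?thesis by (simp add: N_eq[abs_def])
qed

lemma N_deriv: "(N has_vector_derivative g x *\<^sub>R (N2 x - (N x \<bullet> \<kappa> x) *\<^sub>R T x)) (at x)"
  by (rule ds_nabla[OF N_differentiable nabla_T])

lemma V_T: "V x \<bullet> T x = 0"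
  by (simp add: free_elastic_flow_def inner_diff_left nabla_T \<kappa>_T)

lemma N2_eq: "N2 x = - V x - (1/2 * (\<kappa> x \<bullet> \<kappa> x)) *\<^sub>R \<kappa> x"
  by (simp add: free_elastic_flow_def dot_square_norm)

text \<open>
  Up to the divergence on the left, \<open>\<bar>\<nabla>\<^sub>s \<kappa>\<bar>\<^sup>2\<close> is controlled by \<open>V\<close> and \<open>\<kappa>\<close> alone. This is the
  interpolation that the weighted estimate relies on, and also the identity that drives the
  classification of free elasticae.
\<close>

lemma \<kappa>_N_deriv: 
  "((\<lambda>x. \<kappa> x \<bullet> N x) has_real_derivative
     g x * (N x \<bullet> N x - \<kappa> x \<bullet> V x - 1/2 * (\<kappa> x \<bullet> \<kappa> x)\<^sup>2)) (at x)"
  apply (rule DERIV_cong[OF has_real_derivative_inner[OF \<kappa>_deriv N_deriv]])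
  using nabla_T[of "\<kappa>" x] \<kappa>_T[of x]
  by (simp add: N2_eq inner_diff_left inner_diff_right inner_commute algebra_simps power2_eq_square)

end

section \<open>The local energy law\<close>

text \<open>
  The integrand of the bending energy as a function of \<open>a = \<gamma>\<^sub>x\<close> and \<open>b = \<gamma>\<^sub>x\<^sub>x\<close>: as
  \<open>dsgn a b = g \<kappa>\<close>, it equals \<open>g \<bar>\<kappa>\<bar>\<^sup>2 / 2\<close>.
\<close>

definition energy_density :: "'a::real_inner \<Rightarrow> 'a \<Rightarrow> real" where
  "energy_density a b = (dsgn a b \<bullet> dsgn a b) / (2 * norm a)"

text \<open>
  The time derivative of the energy density when \<open>\<partial>\<^sub>t a = p\<close> and \<open>\<partial>\<^sub>t b = q\<close>.
\<close>

definition energy_variation :: "'a::real_inner \<Rightarrow> 'a \<Rightarrow> 'a \<Rightarrow> 'a \<Rightarrow> real" where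
  "energy_variation a b p q = (dsgn a b \<bullet> ddsgn a b p q) / norm a
     - (dsgn a b \<bullet> dsgn a b) * (sgn a \<bullet> p) / (2 * (norm a)\<^sup>2)"

lemma has_real_derivative_energy_density:
  assumes "(a has_vector_derivative p) (at t within S)" "a t \<noteq> 0"
    and "(b has_vector_derivative q) (at t within S)"
  shows "((\<lambda>t. energy_density (a t) (b t)) has_real_derivative
           energy_variation (a t) (b t) p q) (at t within S)"
proof -
  note X = has_vector_derivative_dsgn[OF assms]
  have "((\<lambda>t. (dsgn (a t) (b t) \<bullet> dsgn (a t) (b t)) / (2 * norm (a t))) has_real_derivative
      ((ddsgn (a t) (b t) p q \<bullet> dsgn (a t) (b t) + dsgn (a t) (b t) \<bullet> ddsgn (a t) (b t) p q) * (2 * norm (a t))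
       - (dsgn (a t) (b t) \<bullet> dsgn (a t) (b t)) * (2 * (sgn (a t) \<bullet> p))) / ((2 * norm (a t)) * (2 * norm (a t))))
      (at t within S)"
    by (intro DERIV_divide has_real_derivative_inner X DERIV_cmult has_real_derivative_norm assms)
      (use assms in simp)
  then show ?thesis
    unfolding energy_density_def
    by (rule DERIV_cong) (use assms in \<open>simp add: energy_variation_def inner_commute field_simps power2_eq_square\<close>)
qed

context immersed_curve
begin

lemma energy_density_eq: "energy_density (u1 x) (u2 x) = 1/2 * g x * (\<kappa> x \<bullet> \<kappa> x)"
  using immersed[of x] by (simp add: energy_density_def curvature_eq field_simps)

lemma dsgn_u2: "dsgn (u1 x) (u2 x) = g x *\<^sub>R \<kappa> x"
  using immersed by (simp add: curvature_eq)

context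
  fixes w1 w2 :: "real \<Rightarrow> 'a"
  assumes V_deriv: "\<And>x. (V has_vector_derivative w1 x) (at x)"
    and w1_deriv: "\<And>x. (w1 has_vector_derivative w2 x) (at x)"
begin

abbreviation "W x \<equiv> dsgn (u1 x) (w1 x)"

lemma W_deriv: "(W has_vector_derivative ddsgn (u1 x) (u2 x) (w1 x) (w2 x)) (at x)"
  using has_vector_derivative_dsgn[OF u1_deriv immersed w1_deriv]
  by (simp add: ddsgn_symmetric)

lemma W_T: "W x \<bullet> T x = 0" by (rule dsgn_orthogonal[OF immersed])

text \<open>
  Since \<open>V\<close> is normal, the speed changes by \<open>g\<^sub>t = \<langle>V\<^sub>x, T\<rangle> = - g \<langle>\<kappa>, V\<rangle>\<close>.
\<close>

lemma w1_T: "w1 x \<bullet> T x = - (g x * (\<kappa> x \<bullet> V x))"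
proof -
  have "((\<lambda>x. V x \<bullet> T x) has_real_derivative w1 x \<bullet> T x + V x \<bullet> (g x *\<^sub>R \<kappa> x)) (at x)"
    by (rule has_real_derivative_inner[OF V_deriv T_deriv'])
  moreover have "((\<lambda>x. V x \<bullet> T x) has_real_derivative 0) (at x)"
    by (simp add: V_T)
  ultimately have "w1 x \<bullet> T x + V x \<bullet> (g x *\<^sub>R \<kappa> x) = 0"
    using DERIV_unique by blast
  then show ?thesis by (simp add: inner_commute)
qed

lemma w1_normal: assumes "n \<bullet> T x = 0" shows "n \<bullet> w1 x = g x * (n \<bullet> W x)"
proof -
  have "n \<bullet> w1 x = n \<bullet> ((w1 x \<bullet> T x) *\<^sub>R T x + g x *\<^sub>R W x)"
    using dsgn_decomposition[OF immersed, of "w1 x" x] by simp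
  then show ?thesis using assms by (simp add: inner_add_right)
qed

text \<open>
  The first variation formula before integration. The energy changes at the rate
  \<open>e\<^sub>t = \<langle>\<kappa>, W\<^sub>x\<rangle> + g \<bar>\<kappa>\<bar>\<^sup>2 \<langle>\<kappa>, V\<rangle> / 2\<close> with \<open>W = T\<^sub>t = \<nabla>\<^sub>s V\<close>; moving both derivatives from
  \<open>V\<close> to \<open>\<kappa>\<close> leaves \<open>g \<langle>\<nabla>\<^sub>s\<^sup>2 \<kappa> + \<bar>\<kappa>\<bar>\<^sup>2 \<kappa> / 2, V\<rangle> = - g \<bar>V\<bar>\<^sup>2\<close>.
\<close>

lemma energy_conservation_law:
  "((\<lambda>x. \<kappa> x \<bullet> W x - N x \<bullet> V x) has_real_derivative
     energy_variation (u1 x) (u2 x) (w1 x) (w2 x) + g x * (V x \<bullet> V x)) (at x)"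
proof -
  have "((\<lambda>x. \<kappa> x \<bullet> W x - N x \<bullet> V x) has_real_derivative
     ((g x *\<^sub>R (N x - (\<kappa> x \<bullet> \<kappa> x) *\<^sub>R T x)) \<bullet> W x + \<kappa> x \<bullet> ddsgn (u1 x) (u2 x) (w1 x) (w2 x))
     - ((g x *\<^sub>R (N2 x - (N x \<bullet> \<kappa> x) *\<^sub>R T x)) \<bullet> V x + N x \<bullet> w1 x)) (at x)"
    by (intro DERIV_diff has_real_derivative_inner \<kappa>_deriv W_deriv N_deriv V_deriv)
  moreover have "energy_variation (u1 x) (u2 x) (w1 x) (w2 x)
      = \<kappa> x \<bullet> ddsgn (u1 x) (u2 x) (w1 x) (w2 x) + 1/2 * g x * (\<kappa> x \<bullet> \<kappa> x) * (\<kappa> x \<bullet> V x)"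
    using immersed[of x] w1_T[of x]
    by (simp add: energy_variation_def dsgn_u2 field_simps power2_eq_square inner_commute)
  moreover have "N x \<bullet> w1 x = g x * (N x \<bullet> W x)" by (rule w1_normal[OF nabla_T])
  ultimately show ?thesis
    using W_T[of x] V_T[of x]
    by (elim DERIV_cong) (simp add: N2_eq inner_diff_left inner_commute algebra_simps)
qed

lemma \<kappa>_V_deriv:
  "((\<lambda>x. \<kappa> x \<bullet> V x) has_real_derivative g x * (N x \<bullet> V x + \<kappa> x \<bullet> W x)) (at x)"
  by (rule DERIV_cong[OF has_real_derivative_inner[OF \<kappa>_deriv V_deriv]])
     (use V_T[of x] w1_normal[OF \<kappa>_T] in
      \<open>simp add: inner_diff_left inner_commute[of "T x"] algebra_simps\<close>)

text \<open>
  The flux of the weighted law. The first term is \<open>\<eta>\<close> times the flux of the unweighted law. The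
  second removes \<open>W = \<nabla>\<^sub>s V\<close> from the error \<open>\<eta>' P\<close> by one more integration by parts, so that only
  \<open>V\<close>, \<open>\<kappa>\<close> and \<open>\<nabla>\<^sub>s \<kappa>\<close> remain. The third produces the term \<open>- \<beta> \<eta> g \<bar>\<nabla>\<^sub>s \<kappa>\<bar>\<^sup>2\<close> that absorbs
  the errors containing \<open>\<nabla>\<^sub>s \<kappa>\<close>.
\<close>

definition "flux \<eta> \<eta>' \<beta> x = \<eta> x * (\<kappa> x \<bullet> W x - N x \<bullet> V x)
    - \<eta>' x / g x * (\<kappa> x \<bullet> V x) + \<beta> * (\<eta> x * (\<kappa> x \<bullet> N x))"

lemma flux_deriv:
  assumes \<eta>: "\<And>x. (\<eta> has_real_derivative \<eta>' x) (at x)" "\<And>x. (\<eta>' has_real_derivative \<eta>'' x) (at x)"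
  shows "(flux \<eta> \<eta>' \<beta> has_real_derivative
     \<eta> x * (energy_variation (u1 x) (u2 x) (w1 x) (w2 x) + g x * (V x \<bullet> V x))
     - 2 * \<eta>' x * (N x \<bullet> V x)
     - (\<eta>'' x / g x - \<eta>' x * (T x \<bullet> u2 x) / (g x)\<^sup>2) * (\<kappa> x \<bullet> V x)
     + \<beta> * (\<eta>' x * (\<kappa> x \<bullet> N x)
        + \<eta> x * g x * (N x \<bullet> N x - \<kappa> x \<bullet> V x - 1/2 * (\<kappa> x \<bullet> \<kappa> x)\<^sup>2))) (at x)"
proof -
  have "(flux \<eta> \<eta>' \<beta> has_real_derivative
     (\<eta>' x * (\<kappa> x \<bullet> W x - N x \<bullet> V x)
       + (energy_variation (u1 x) (u2 x) (w1 x) (w2 x) + g x * (V x \<bullet> V x)) * \<eta> x)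
     - ((\<eta>'' x * g x - \<eta>' x * (T x \<bullet> u2 x)) / (g x * g x) * (\<kappa> x \<bullet> V x)
        + g x * (N x \<bullet> V x + \<kappa> x \<bullet> W x) * (\<eta>' x / g x))
     + \<beta> * (\<eta>' x * (\<kappa> x \<bullet> N x)
        + (g x * (N x \<bullet> N x - \<kappa> x \<bullet> V x - 1/2 * (\<kappa> x \<bullet> \<kappa> x)\<^sup>2)) * \<eta> x)) (at x)"
    unfolding flux_def[abs_def]
    by (intro DERIV_add DERIV_diff DERIV_mult DERIV_cmult DERIV_divide \<eta> energy_conservation_law
        \<kappa>_V_deriv \<kappa>_N_deriv has_real_derivative_norm[OF u1_deriv immersed]) (use immersed in simp)
  then show ?thesis
    by (rule DERIV_cong) (use immersed[of x] in \<open>simp add: field_simps power2_eq_square\<close>)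
qed

end
end

section \<open>Absorbing the errors of a slowly varying weight\<close>

lemma abs_inner_le_mean_square: "\<bar>a \<bullet> b\<bar> \<le> (a \<bullet> a + b \<bullet> b) / 2" for a b :: "'a::real_inner"
proof -
  have "0 \<le> (a - b) \<bullet> (a - b)" "0 \<le> (a + b) \<bullet> (a + b)" by (rule inner_ge_zero)+
  then show ?thesis by (simp add: inner_diff_left inner_diff_right inner_add_left inner_add_right inner_commute)
qed

text \<open>
  Here \<open>k2, n2, v2\<close> stand for the squared norms of \<open>\<kappa>, \<nabla>\<^sub>s \<kappa>, V\<close>, the names \<open>kv, nv, kn\<close>
  for their inner products, and \<open>gx\<close> for \<open>g\<^sub>x\<close>. The factor \<open>\<beta> = 2 \<delta> / m\<close> of the interpolation term is chosen so
  that the total coefficient of \<open>n2\<close> is \<open>\<delta> / m + \<beta> / 2 - \<beta> = 0\<close>; the smallness of \<open>\<delta>\<close>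
  bounds the contribution of \<open>v2\<close> by half of the dissipation, and the rest is a multiple of \<open>\<delta> k2\<close>.
\<close>

lemma absorption_inequality:
  fixes A \<eta> \<eta>' \<eta>'' g gx k2 n2 v2 kv nv kn m M K \<delta> :: real
  assumes m: "0 < m" "m \<le> g" and M: "\<bar>gx\<bar> \<le> M" and K: "0 \<le> k2" "k2 \<le> K" and nn: "0 \<le> n2" "0 \<le> v2"
    and ip: "\<bar>kv\<bar> \<le> (k2 + v2) / 2" "\<bar>nv\<bar> \<le> (n2 + v2) / 2" "\<bar>kn\<bar> \<le> (k2 + n2) / 2"
    and \<eta>: "0 \<le> \<eta>" "\<bar>\<eta>'\<bar> \<le> \<delta> * \<eta>" "\<bar>\<eta>''\<bar> \<le> \<delta> * \<eta>"
    and \<delta>: "0 \<le> \<delta>" "\<delta> \<le> m" "\<delta> * (2 / m + (1 / m\<^sup>2 + M / m^3) / 2) \<le> 1/2"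
  shows "2 * \<eta>' * nv + (\<eta>'' / g - \<eta>' * gx / g\<^sup>2) * kv
     - (2 * \<delta> / m) * (\<eta>' * kn + \<eta> * g * (n2 - kv - 1/2 * k2\<^sup>2))
     \<le> 1/2 * \<eta> * g * v2 + \<delta> * ((1 / m\<^sup>2 + M / m^3) + 4 / m + 2 * K / m) * (\<eta> * (1/2 * g * k2))"
proof -
  define A where "A = \<eta> * g"
  define C1 where "C1 = 1 / m\<^sup>2 + M / m^3"
  define \<beta> where "\<beta> = 2 * \<delta> / m"
  have A: "0 \<le> A" "\<eta> \<le> A / m" and g: "0 < g" and M0: "0 \<le> M" and \<beta>: "0 \<le> \<beta>"
    using m \<eta> M \<delta> by (auto simp: A_def \<beta>_def field_simps mult_left_mono)
  have \<eta>'A: "\<bar>\<eta>'\<bar> \<le> \<delta> / m * A"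
    using \<eta>(2) mult_left_mono[OF A(2) \<delta>(1)] by simp
  have t1: "2 * \<eta>' * nv \<le> \<delta> / m * A * (n2 + v2)"
  proof -
    have "\<eta>' * nv \<le> \<bar>\<eta>'\<bar> * \<bar>nv\<bar>" by (metis abs_ge_self abs_mult)
    also have "\<dots> \<le> (\<delta> / m * A) * ((n2 + v2) / 2)" by (rule mult_mono[OF \<eta>'A ip(2)]) (use A \<delta> m in auto)
    also have "\<dots> = \<delta> / m * A * (n2 + v2) / 2" by simp
    finally have "2 * (\<eta>' * nv) \<le> 2 * (\<delta> / m * A * (n2 + v2) / 2)" by (rule mult_left_mono) simp
    then show ?thesis by (simp add: mult.assoc)
  qed
  have t2: "(\<eta>'' / g - \<eta>' * gx / g\<^sup>2) * kv \<le> \<delta> * A * C1 * ((k2 + v2) / 2)"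
  proof -
    have "\<bar>\<eta>'' / g\<bar> \<le> \<delta> * A * (1 / m\<^sup>2)"
    proof -
      have "\<bar>\<eta>'' / g\<bar> \<le> \<delta> * \<eta> / g" using \<eta> g by (simp add: abs_divide divide_right_mono)
      also have "\<dots> = \<delta> * A * (1 / g\<^sup>2)" using g by (simp add: A_def power2_eq_square)
      also have "\<dots> \<le> \<delta> * A * (1 / m\<^sup>2)"
        using m \<delta> A by (intro mult_left_mono divide_left_mono power_mono) auto
      finally show ?thesis .
    qed
    moreover have "\<bar>\<eta>' * gx / g\<^sup>2\<bar> \<le> \<delta> * A * (M / m^3)"
    proof -
      have "\<bar>\<eta>' * gx / g\<^sup>2\<bar> \<le> (\<delta> * \<eta>) * M / g\<^sup>2" 
        using \<eta> M g \<delta> by (simp add: abs_mult divide_right_mono mult_mono)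
      also have "\<dots> = \<delta> * A * (M / g^3)" using g by (simp add: A_def power2_eq_square power3_eq_cube)
      also have "\<dots> \<le> \<delta> * A * (M / m^3)"
        using m \<delta> A M0 by (intro mult_left_mono divide_left_mono power_mono) auto
      finally show ?thesis .
    qed
    ultimately have "\<bar>\<eta>'' / g - \<eta>' * gx / g\<^sup>2\<bar> \<le> \<delta> * A * C1"
      unfolding C1_def distrib_left by linarith
    then have "\<bar>\<eta>'' / g - \<eta>' * gx / g\<^sup>2\<bar> * \<bar>kv\<bar> \<le> \<delta> * A * C1 * ((k2 + v2) / 2)"
      by (rule mult_mono[OF _ ip(1)]) (use \<delta> A m M0 in \<open>simp_all add: C1_def\<close>)
    then show ?thesis by (metis abs_ge_self abs_mult order_trans)
  qed
  have t3: "- (\<beta> * (\<eta>' * kn)) \<le> \<beta> * A * ((k2 + n2) / 2)"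
  proof -
    (* the factor \<beta> is already of order \<delta>, so \<eta>' may be estimated crudely by A *)
    have "\<delta> / m * A \<le> A" using \<delta> m A by (intro mult_left_le_one_le) auto
    then have "\<bar>\<eta>'\<bar> * \<bar>kn\<bar> \<le> A * ((k2 + n2) / 2)"
      using \<eta>'A by (intro mult_mono ip(3)) (use A in auto)
    then have "- (\<eta>' * kn) \<le> A * ((k2 + n2) / 2)"
      unfolding abs_mult[symmetric] by linarith
    from mult_left_mono[OF this \<beta>] show ?thesis by simp
  qed
  have t4: "\<beta> * A * kv \<le> \<beta> * A * ((k2 + v2) / 2)"
    using ip(1) \<beta> A by (intro mult_left_mono) auto
  have t5: "\<beta> * A * (k2\<^sup>2) \<le> \<beta> * A * (K * k2)"
    using K \<beta> A by (intro mult_left_mono) (auto simp: power2_eq_square mult_right_mono)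
  have "2 * \<eta>' * nv + (\<eta>'' / g - \<eta>' * gx / g\<^sup>2) * kv - \<beta> * (\<eta>' * kn + A * (n2 - kv - 1/2 * k2\<^sup>2))
     \<le> \<delta> / m * A * (n2 + v2) + \<delta> * A * C1 * ((k2 + v2) / 2) + \<beta> * A * ((k2 + n2) / 2)
        - \<beta> * A * n2 + \<beta> * A * ((k2 + v2) / 2) + 1/2 * (\<beta> * A * (K * k2))"
  proof -
    have "\<beta> * (\<eta>' * kn + A * (n2 - kv - 1/2 * k2\<^sup>2))
      = \<beta> * (\<eta>' * kn) + \<beta> * A * n2 - \<beta> * A * kv - 1/2 * (\<beta> * A * k2\<^sup>2)"
      by (simp add: algebra_simps)
    then show ?thesis using t1 t2 t3 t4 t5 by linarith
  qed
  also have "\<dots> = (A * v2) * (\<delta> * (2 / m + C1 / 2)) + \<delta> * (C1 + 4 / m + 2 * K / m) * (A * k2 / 2)"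
    using m by (simp add: \<beta>_def field_simps)
  also have "\<dots> \<le> (A * v2) * (1/2) + \<delta> * (C1 + 4 / m + 2 * K / m) * (A * k2 / 2)"
    using \<delta>(3) A nn by (intro add_right_mono mult_left_mono) (auto simp: C1_def)
  finally show ?thesis by (simp add: A_def C1_def \<beta>_def algebra_simps)
qed

lemma normal_part_norm_le: assumes "a \<noteq> 0" shows "norm (normal_part a v) \<le> norm v"
proof -
  have "normal_part a v \<bullet> normal_part a v = v \<bullet> normal_part a v"
    using normal_part_orthogonal[OF assms, of v] by (rule inner_normal_part)
  then have "(norm (normal_part a v))\<^sup>2 \<le> norm v * norm (normal_part a v)"
    by (metis dot_square_norm norm_cauchy_schwarz)
  then show ?thesis
    by (cases "normal_part a v = 0") (simp_all add: power2_eq_square mult_le_cancel_right)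
qed

context immersed_curve
begin
context
  fixes w1 w2 :: "real \<Rightarrow> 'a"
  assumes V_deriv: "\<And>x. (V has_vector_derivative w1 x) (at x)"
    and w1_deriv: "\<And>x. (w1 has_vector_derivative w2 x) (at x)"
begin

text \<open>
  All terms that \<open>\<eta>\<close> adds to the local energy law are dominated pointwise, before any
  integration, by quantities that carry the same weight \<open>\<eta>\<close>. This is what turns integration over
  \<open>[-R, R]\<close> into an estimate uniform in \<open>R\<close>.
\<close>

lemma flux_inequality:
  assumes \<eta>: "\<And>x. (\<eta> has_real_derivative \<eta>' x) (at x)" "\<And>x. (\<eta>' has_real_derivative \<eta>'' x) (at x)"
    and bounds: "0 < m" "m \<le> g x" "norm (u2 x) \<le> M" "\<kappa> x \<bullet> \<kappa> x \<le> K"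
    and weight: "0 \<le> \<eta> x" "\<bar>\<eta>' x\<bar> \<le> \<delta> * \<eta> x" "\<bar>\<eta>'' x\<bar> \<le> \<delta> * \<eta> x"
    and \<delta>: "0 \<le> \<delta>" "\<delta> \<le> m" "\<delta> * (2 / m + (1 / m\<^sup>2 + M / m^3) / 2) \<le> 1/2"
  shows "\<exists>f'. (flux w1 \<eta> \<eta>' (2 * \<delta> / m) has_real_derivative f') (at x) \<and>
     \<eta> x * energy_variation (u1 x) (u2 x) (w1 x) (w2 x) + 1/2 * (\<eta> x * g x * (V x \<bullet> V x))
     \<le> f' + \<delta> * ((1 / m\<^sup>2 + M / m^3) + 4 / m + 2 * K / m) * (\<eta> x * energy_density (u1 x) (u2 x))"
proof -
  have "\<bar>T x \<bullet> u2 x\<bar> \<le> norm (T x) * norm (u2 x)" by (rule Cauchy_Schwarz_ineq2)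
  then have gx: "\<bar>T x \<bullet> u2 x\<bar> \<le> M" using bounds(3) immersed[of x] by (simp add: norm_sgn)
  note ineq = absorption_inequality[OF bounds(1,2) gx inner_ge_zero bounds(4) inner_ge_zero inner_ge_zero
      abs_inner_le_mean_square abs_inner_le_mean_square abs_inner_le_mean_square weight \<delta>,
      of "N x" "V x"]
  show ?thesis
    by (rule exI, rule conjI, rule flux_deriv[OF V_deriv w1_deriv \<eta>])
      (use ineq in \<open>simp add: energy_density_eq algebra_simps\<close>)
qed

lemma flux_bound:
  assumes "0 < m" "m \<le> g x" "0 \<le> B" "norm (\<kappa> x) \<le> B" "norm (N x) \<le> B" "norm (V x) \<le> B"
    "norm (dsgn (u1 x) (w1 x)) \<le> B"
    and "0 \<le> \<delta>" "0 \<le> \<eta> x" "\<eta> x \<le> 1" "\<eta> x \<le> \<delta>" "\<bar>\<eta>' x\<bar> \<le> \<delta> * \<eta> x"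
  shows "\<bar>flux w1 \<eta> \<eta>' (2 * \<delta> / m) x\<bar> \<le> \<delta> * (2 * B\<^sup>2 + 3 * B\<^sup>2 / m)"
proof -
  have ip: "\<bar>p \<bullet> q\<bar> \<le> B\<^sup>2" if "norm p \<le> B" "norm q \<le> B" for p q :: 'a
    using Cauchy_Schwarz_ineq2[of p q] mult_mono[OF that assms(3)] by (simp add: power2_eq_square)
  have a: "\<bar>\<eta> x * (\<kappa> x \<bullet> dsgn (u1 x) (w1 x) - N x \<bullet> V x)\<bar> \<le> \<delta> * (2 * B\<^sup>2)"
    unfolding abs_mult using ip[OF assms(4,7)] ip[OF assms(5,6)] assms by (intro mult_mono) auto
  have "\<delta> * \<eta> x \<le> \<delta>" using assms by (simp add: mult_left_le)
  then have "\<bar>\<eta>' x\<bar> / g x \<le> \<delta> / m" using assms by (intro frac_le) auto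
  then have b: "\<bar>\<eta>' x / g x * (\<kappa> x \<bullet> V x)\<bar> \<le> \<delta> / m * B\<^sup>2"
    unfolding abs_mult abs_divide using ip[OF assms(4,6)] assms by (intro mult_mono) auto
  have "\<bar>\<eta> x * (\<kappa> x \<bullet> N x)\<bar> \<le> 1 * B\<^sup>2"
    unfolding abs_mult using ip[OF assms(4,5)] assms by (intro mult_mono) auto
  then have c: "\<bar>2 * \<delta> / m * (\<eta> x * (\<kappa> x \<bullet> N x))\<bar> \<le> 2 * \<delta> / m * B\<^sup>2"
    unfolding abs_mult[of "2 * \<delta> / m"] using assms by (intro mult_mono) auto
  have "\<bar>flux w1 \<eta> \<eta>' (2 * \<delta> / m) x\<bar> \<le> \<delta> * (2 * B\<^sup>2) + \<delta> / m * B\<^sup>2 + 2 * \<delta> / m * B\<^sup>2"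
    unfolding flux_def[OF V_deriv w1_deriv] using a b c by linarith
  then show ?thesis by (simp add: algebra_simps add_divide_distrib)
qed
end
end

section \<open>Solutions on a time slab\<close>

lemma at_within_slab: "0 < T' \<Longrightarrow> t \<in> {0..T'} \<Longrightarrow> at t within {0..T'} \<noteq> (bot :: real filter)"
  by (simp add: at_within_Icc_at trivial_limit_within islimpt_Icc)

text \<open>
  Smoothness on the slab speaks of \<open>\<partial>\<^sub>t\<^sup>a \<partial>\<^sub>x\<^sup>b\<close> only, in this order, so \<open>\<partial>\<^sub>x \<partial>\<^sub>t U\<close> has to be computed. In
  \<open>U t y = U t a + \<integral> \<partial>\<^sub>x U\<close> the integral may be differentiated in \<open>t\<close>, and the result in \<open>y\<close>.
\<close>

lemma mixed_partial_derivative: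
  fixes U :: "real \<Rightarrow> real \<Rightarrow> 'a::euclidean_space"
  assumes "0 < T'"
    and Ux: "\<And>t x. t \<in> {0..T'} \<Longrightarrow> (U t has_vector_derivative Ux t x) (at x)"
    and Ut: "\<And>t x. t \<in> {0..T'} \<Longrightarrow> ((\<lambda>\<tau>. U \<tau> x) has_vector_derivative Ut t x) (at t within {0..T'})"
    and Utx: "\<And>t x. t \<in> {0..T'} \<Longrightarrow> ((\<lambda>\<tau>. Ux \<tau> x) has_vector_derivative Utx t x) (at t within {0..T'})"
    and cont: "continuous_on ({0..T'} \<times> UNIV) (\<lambda>(t, x). Utx t x)"
    and t: "t \<in> {0..T'}"
  shows "(Ut t has_vector_derivative Utx t x) (at x)"
proof -
  define a where "a = x - 1"
  have ftc: "(Ux \<tau> has_integral (U \<tau> y - U \<tau> a)) {a..y}" if "\<tau> \<in> {0..T'}" "a \<le> y" for \<tau> y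
    by (rule fundamental_theorem_of_calculus[OF that(2)])
       (meson Ux has_vector_derivative_at_within that(1))
  have eq: "Ut t y = Ut t a + integral {a..y} (Utx t)" if y: "y \<in> {a..x + 1}" for y
  proof -
    have ay: "a \<le> y" using y by simp
    have "((\<lambda>\<tau>. integral (cbox a y) (Ux \<tau>)) has_vector_derivative integral (cbox a y) (Utx t))
        (at t within {0..T'})"
    proof (rule leibniz_rule_vector_derivative)
      show "continuous_on ({0..T'} \<times> cbox a y) (\<lambda>(t, x). Utx t x)"
        by (rule continuous_on_subset[OF cont]) auto
      show "Ux \<tau> integrable_on cbox a y" if "\<tau> \<in> {0..T'}" for \<tau>
        using ftc[OF that ay] by auto
    qed (use Utx t in auto)
    moreover have "((\<lambda>\<tau>. U \<tau> y - U \<tau> a) has_vector_derivative Ut t y - Ut t a) (at t within {0..T'})"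
      by (intro has_vector_derivative_diff Ut t)
    then have "((\<lambda>\<tau>. integral (cbox a y) (Ux \<tau>)) has_vector_derivative Ut t y - Ut t a)
        (at t within {0..T'})"
      by (rule has_vector_derivative_transform[OF t, rotated])
         (use ftc[OF _ ay] in \<open>simp add: integral_unique\<close>)
    moreover note at_within_slab[OF \<open>0 < T'\<close> t]
    ultimately show ?thesis
      using vector_derivative_unique_within by (fastforce simp: algebra_simps)
  qed
  have "continuous_on {a..x + 1} (\<lambda>y. (\<lambda>(t, x). Utx t x) (t, y))"
    by (rule continuous_on_compose2[OF cont]) (use t in \<open>auto intro!: continuous_intros\<close>)
  then have *: "((\<lambda>y. Ut t a + integral {a..y} (Utx t)) has_vector_derivative 0 + Utx t x) (at x within {a..x + 1})"
    by (intro has_vector_derivative_add integral_has_vector_derivative) (auto simp: a_def)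
  have "(Ut t has_vector_derivative Utx t x) (at x within {a..x + 1})"
    by (rule has_vector_derivative_transform[where S = "{a..x + 1}", OF _ eq])
       (use * in \<open>simp_all add: a_def\<close>)
  moreover have "at x within {a..x + 1} = at x" by (rule at_within_Icc_at) (auto simp: a_def)
  ultimately show ?thesis by simp
qed

lemma Dx_power: "(Dx ^^ b) u t = (D ^^ b) (u t)"
  by (induction b arbitrary: u) (simp_all add: funpow_swap1[symmetric] Dx_def[abs_def])

lemma partial_0: "partial T' 0 b u t = (D ^^ b) (u t)"
  by (simp add: partial_def Dx_power)

lemma smooth_slab_smooth: "smooth_slab T' u \<Longrightarrow> t \<in> {0..T'} \<Longrightarrow> smooth (u t)"
  unfolding smooth_slab_def smooth_def by (metis partial_0)

lemma D_power_diff: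
  assumes "smooth f" "smooth h"
  shows "(D ^^ k) (\<lambda>x. f x - h x) = (\<lambda>x. (D ^^ k) f x - (D ^^ k) h x)"
proof (induction k)
  case (Suc k)
  show ?case
    using has_vector_derivative_diff[OF smooth_has_vector_derivative[OF assms(1), of k]
        smooth_has_vector_derivative[OF assms(2), of k]]
    by (auto simp: Suc fun_eq_iff intro!: D_eqI)
qed simp

lemma partial_has_time_derivative:
  assumes "smooth_slab T' u" "t \<in> {0..T'}"
  shows "((\<lambda>\<tau>. partial T' a b u \<tau> x) has_vector_derivative partial T' (Suc a) b u t x) (at t within {0..T'})"
  using assms by (simp add: smooth_slab_def partial_def Dt_def vector_derivative_works)

lemma continuous_on_dsgn [continuous_intros]:
  assumes "continuous_on S a" "continuous_on S v" "\<And>x. x \<in> S \<Longrightarrow> a x \<noteq> 0"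
  shows "continuous_on S (\<lambda>x. dsgn (a x) (v x))"
  unfolding dsgn_def normal_part_def using assms by (intro continuous_intros) auto

lemma continuous_on_ddsgn [continuous_intros]:
  assumes "continuous_on S a" "continuous_on S v" "continuous_on S p" "continuous_on S q"
    "\<And>x. x \<in> S \<Longrightarrow> a x \<noteq> 0"
  shows "continuous_on S (\<lambda>x. ddsgn (a x) (v x) (p x) (q x))"
  unfolding ddsgn_def normal_part_def using assms by (intro continuous_intros) auto

lemma continuous_on_energy_density [continuous_intros]:
  assumes "continuous_on S a" "continuous_on S v" "\<And>x. x \<in> S \<Longrightarrow> a x \<noteq> 0"
  shows "continuous_on S (\<lambda>x. energy_density (a x) (v x))"
  unfolding energy_density_def using assms by (intro continuous_intros) auto

lemma continuous_on_energy_variation [continuous_intros]: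
  assumes "continuous_on S a" "continuous_on S v" "continuous_on S p" "continuous_on S q"
    "\<And>x. x \<in> S \<Longrightarrow> a x \<noteq> 0"
  shows "continuous_on S (\<lambda>x. energy_variation (a x) (v x) (p x) (q x))"
  unfolding energy_variation_def using assms by (intro continuous_intros) auto

locale elastic_flow =
  fixes T' :: real and \<gamma>0 :: "real \<Rightarrow> 'a::euclidean_space" and \<gamma>
  assumes T'_pos: "0 < T'" and initial: "\<gamma>0 \<in> Cdot_infty"
    and solution: "flow_solution free_elastic_flow T' \<gamma>0 \<gamma>"
begin

abbreviation "u b t \<equiv> (D ^^ b) (\<gamma> t)"

text \<open>
  The function \<open>w b = \<partial>\<^sub>t \<partial>\<^sub>x\<^sup>b \<gamma>\<close> is also \<open>\<partial>\<^sub>x\<^sup>b V\<close>, by \<open>w0_eq\<close> and \<open>w_deriv\<close>. In the first form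
  it inherits continuity and bounds from the solution, so the derivatives of order four and more
  hidden in \<open>V\<close> and \<open>V\<^sub>x\<close> are never estimated one by one.
\<close>

abbreviation "w b \<equiv> partial T' 1 b \<gamma>"

lemma slab: "smooth_slab T' \<gamma>" using solution by (simp add: flow_solution_def)

lemma u_deriv:
  assumes "t \<in> {0..T'}"
  shows "(u b t has_vector_derivative u (Suc b) t x) (at x)"
  by (rule smooth_has_vector_derivative[OF smooth_slab_smooth[OF slab assms]])

lemma u_time_deriv:
  assumes "t \<in> {0..T'}"
  shows "((\<lambda>\<tau>. u b \<tau> x) has_vector_derivative w b t x) (at t within {0..T'})"
  using partial_has_time_derivative[OF slab assms, of 0 b x] by (simp add: partial_0)

lemma u_cont: "continuous_on ({0..T'} \<times> UNIV) (\<lambda>(t, x). u b t x)"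
  using slab unfolding smooth_slab_def by (metis (no_types, lifting) partial_0 continuous_on_cong split_def)

lemma w_cont: "continuous_on ({0..T'} \<times> UNIV) (\<lambda>(t, x). w b t x)"
  using slab unfolding smooth_slab_def by blast

lemma w_deriv:
  assumes "t \<in> {0..T'}"
  shows "(w b t has_vector_derivative w (Suc b) t x) (at x)"
  by (rule mixed_partial_derivative[where U = "u b" and Ux = "u (Suc b)", OF T'_pos
        u_deriv u_time_deriv u_time_deriv w_cont assms])

lemma speed_lower_bound: "\<exists>m>0. \<forall>t\<in>{0..T'}. \<forall>x. m \<le> norm (D (\<gamma> t) x)"
proof -
  let ?m = "INF (t, x)\<in>{0..T'} \<times> UNIV. norm (Dx \<gamma> t x)"
  have "bdd_below ((\<lambda>(t, x). norm (Dx \<gamma> t x)) ` ({0..T'} \<times> UNIV))"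
    by (rule bdd_belowI[of _ 0]) auto
  then have "?m \<le> norm (D (\<gamma> t) x)" if "t \<in> {0..T'}" for t x
    using cINF_lower[of "\<lambda>(t, x). norm (Dx \<gamma> t x)" "{0..T'} \<times> UNIV" "(t, x)"] that
    by (simp add: Dx_def[symmetric])
  moreover have "0 < ?m" using solution by (simp add: flow_solution_def)
  ultimately show ?thesis by blast
qed

lemma immersed_curve: "t \<in> {0..T'} \<Longrightarrow> immersed_curve (\<gamma> t)"
  using speed_lower_bound smooth_slab_smooth[OF slab]
  by (metis immersed_curve.intro less_le_not_le norm_zero)

lemma w0_eq: "t \<in> {0..T'} \<Longrightarrow> w 0 t = free_elastic_flow (\<gamma> t)"
  using solution by (simp add: flow_solution_def partial_def fun_eq_iff)

lemma initial_smooth: "smooth \<gamma>0" using initial by (simp add: Cdot_infty_def)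

lemma bounded_u:
  assumes "1 \<le> b" shows "\<exists>M. \<forall>t\<in>{0..T'}. \<forall>x. norm (u b t x) \<le> M"
proof -
  have "bounded ((\<lambda>(t, x). partial T' 0 b (\<lambda>t x. \<gamma> t x - \<gamma>0 x) t x) ` ({0..T'} \<times> UNIV))"
    using solution by (simp add: flow_solution_def C_infty_slab_def)
  then obtain M1 where M1: "\<And>t x. t \<in> {0..T'} \<Longrightarrow> norm (partial T' 0 b (\<lambda>t x. \<gamma> t x - \<gamma>0 x) t x) \<le> M1"
    unfolding bounded_iff by fastforce
  obtain M2 where M2: "\<And>x. norm ((D ^^ b) \<gamma>0 x) \<le> M2"
    using initial assms unfolding Cdot_infty_def bounded_iff by fastforce
  have "norm (u b t x) \<le> M1 + M2" if t: "t \<in> {0..T'}" for t x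
    using M1[OF t, of x] M2[of x] D_power_diff[OF smooth_slab_smooth[OF slab t] initial_smooth]
      norm_triangle_sub[of "u b t x" "(D ^^ b) \<gamma>0 x"]
    by (simp add: partial_0)
  then show ?thesis by blast
qed

lemma bounded_w: "\<exists>M. \<forall>t\<in>{0..T'}. \<forall>x. norm (w b t x) \<le> M"
proof -
  have "bounded ((\<lambda>(t, x). partial T' 1 b (\<lambda>t x. \<gamma> t x - \<gamma>0 x) t x) ` ({0..T'} \<times> UNIV))"
    using solution by (simp add: flow_solution_def C_infty_slab_def)
  then obtain M where M: "\<And>t x. t \<in> {0..T'} \<Longrightarrow> norm (partial T' 1 b (\<lambda>t x. \<gamma> t x - \<gamma>0 x) t x) \<le> M"
    unfolding bounded_iff by fastforce
  have "partial T' 1 b (\<lambda>t x. \<gamma> t x - \<gamma>0 x) t x = w b t x" if t: "t \<in> {0..T'}" for t x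
  proof -
    have "((\<lambda>\<tau>. u b \<tau> x - (D ^^ b) \<gamma>0 x) has_vector_derivative w b t x) (at t within {0..T'})"
      using has_vector_derivative_diff[OF u_time_deriv[OF t] has_vector_derivative_const] by simp
    then have "((\<lambda>\<tau>. (D ^^ b) (\<lambda>x. \<gamma> \<tau> x - \<gamma>0 x) x) has_vector_derivative w b t x) (at t within {0..T'})"
      by (rule has_vector_derivative_transform[OF t, rotated])
         (simp_all add: D_power_diff[OF smooth_slab_smooth[OF slab] initial_smooth])
    then show ?thesis
      using at_within_slab[OF T'_pos t]
      by (simp add: partial_def Dt_def Dx_power vector_derivative_within)
  qed
  with M show ?thesis by metis
qed

end

section \<open>The weighted energy\<close>

text \<open>
  A weight on \<open>[-R, R]\<close> with first and second derivatives relatively small, so that each error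
  still carries the full factor \<open>\<eta>\<close>. Such a weight, unless it is zero, has no zeros in \<open>[-R, R]\<close>;
  hence smallness at \<open>\<plusminus>R\<close> takes the place of compact support.
\<close>

definition slowly_varying_weight ::
    "real \<Rightarrow> real \<Rightarrow> (real \<Rightarrow> real) \<Rightarrow> (real \<Rightarrow> real) \<Rightarrow> (real \<Rightarrow> real) \<Rightarrow> bool" where
  "slowly_varying_weight \<delta> R \<eta> \<eta>' \<eta>'' \<longleftrightarrow> 0 \<le> \<delta> \<and> 0 \<le> R \<and>
     (\<forall>x. (\<eta> has_real_derivative \<eta>' x) (at x)) \<and> (\<forall>x. (\<eta>' has_real_derivative \<eta>'' x) (at x)) \<and>
     (\<forall>x\<in>{-R..R}. 0 \<le> \<eta> x \<and> \<eta> x \<le> 1 \<and> \<bar>\<eta>' x\<bar> \<le> \<delta> * \<eta> x \<and> \<bar>\<eta>'' x\<bar> \<le> \<delta> * \<eta> x) \<and>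
     \<eta> (-R) \<le> \<delta> \<and> \<eta> R \<le> \<delta>"

context elastic_flow
begin

abbreviation "ux t \<equiv> D (\<gamma> t)"
abbreviation "uxx t \<equiv> D (D (\<gamma> t))"
abbreviation "uxxx t \<equiv> D (D (D (\<gamma> t)))"

lemma u_eq: "u 1 t = ux t" "u 2 t = uxx t" "u 3 t = uxxx t"
  by (simp_all add: numeral_2_eq_2 numeral_3_eq_3)

text \<open>
  Uniform bounds on the whole slab. The bound of \<open>\<nabla>\<^sub>s \<kappa>\<close> comes from compactness: it is a continuous
  function of the first three derivatives, which stay in a compact set that avoids \<open>\<gamma>\<^sub>x = 0\<close>.
\<close>

lemma geometric_bounds:
  obtains m B where "0 < m" "0 \<le> B"
    and "\<And>t x. t \<in> {0..T'} \<Longrightarrow> m \<le> norm (ux t x)"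
    and "\<And>t x. t \<in> {0..T'} \<Longrightarrow> norm (uxx t x) \<le> B"
    and "\<And>t x. t \<in> {0..T'} \<Longrightarrow> norm (curvature (\<gamma> t) x) \<le> B"
    and "\<And>t x. t \<in> {0..T'} \<Longrightarrow> norm (nabla_s (\<gamma> t) (curvature (\<gamma> t)) x) \<le> B"
    and "\<And>t x. t \<in> {0..T'} \<Longrightarrow> norm (free_elastic_flow (\<gamma> t) x) \<le> B"
    and "\<And>t x. t \<in> {0..T'} \<Longrightarrow> norm (dsgn (ux t x) (w 1 t x)) \<le> B"
proof -
  obtain m where m: "0 < m" "\<And>t x. t \<in> {0..T'} \<Longrightarrow> m \<le> norm (ux t x)"
    using speed_lower_bound by auto
  obtain M1 M2 M3 where M: "\<And>t x. t \<in> {0..T'} \<Longrightarrow> norm (ux t x) \<le> M1"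
    "\<And>t x. t \<in> {0..T'} \<Longrightarrow> norm (uxx t x) \<le> M2" "\<And>t x. t \<in> {0..T'} \<Longrightarrow> norm (uxxx t x) \<le> M3"
    using bounded_u[of 1, unfolded u_eq] bounded_u[of 2, unfolded u_eq] bounded_u[of 3, unfolded u_eq]
    by (metis one_le_numeral order_refl)
  obtain B0 B1 where B: "\<And>t x. t \<in> {0..T'} \<Longrightarrow> norm (w 0 t x) \<le> B0"
     "\<And>t x. t \<in> {0..T'} \<Longrightarrow> norm (w 1 t x) \<le> B1"
    using bounded_w[of 0] bounded_w[of 1] by metis
  have dsgn_le: "norm (dsgn (ux t x) v) \<le> norm v / m" if "t \<in> {0..T'}" for t x v
  proof -
    have "ux t x \<noteq> 0" using m(1) m(2)[OF that, of x] by auto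
    from normal_part_norm_le[OF this, of v]
    have "norm (normal_part (ux t x) v) / norm (ux t x) \<le> norm v / m"
      using m(1) m(2)[OF that, of x] by (intro frac_le) auto
    then show ?thesis by (simp add: dsgn_def divide_inverse_commute)
  qed
  let ?K = "(cball 0 M1 - ball 0 m) \<times> cball 0 M2 \<times> cball 0 M3 :: ('a \<times> 'a \<times> 'a) set"
  let ?F = "\<lambda>p::'a \<times> 'a \<times> 'a. let a = fst p; b = fst (snd p); c = snd (snd p) in
      dsgn a (inverse (norm a) *\<^sub>R ddsgn a b b c
        - (inverse (norm a) * (sgn a \<bullet> b) * inverse (norm a)) *\<^sub>R dsgn a b)"
  have "compact ?K" by (intro compact_Times compact_diff compact_cball open_ball)
  moreover have "continuous_on ?K ?F"
    unfolding Let_def using m(1) by (intro continuous_intros) auto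
  ultimately have "bounded (?F ` ?K)"
    by (intro compact_imp_bounded compact_continuous_image)
  then obtain B2 where B2: "\<And>p. p \<in> ?K \<Longrightarrow> norm (?F p) \<le> B2" unfolding bounded_iff by blast
  define B where "B = max 0 (max M2 (max (M2 / m / m) (max B2 (max B0 (B1 / m)))))"
  have B_ge: "0 \<le> B" "M2 \<le> B" "M2 / m / m \<le> B" "B2 \<le> B" "B0 \<le> B" "B1 / m \<le> B"
    unfolding B_def by linarith+
  show thesis
  proof (rule that[of m B])
    fix t x assume t: "t \<in> {0..T'}"
    interpret immersed_curve "\<gamma> t" by (rule immersed_curve[OF t])
    show "norm (uxx t x) \<le> B" using M(2)[OF t, of x] B_ge by simp
    have "norm (\<kappa> x) = norm (dsgn (ux t x) (uxx t x)) / norm (ux t x)"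
      by (simp add: curvature_eq divide_inverse_commute)
    also have "\<dots> \<le> (M2 / m) / m"
      using order_trans[OF dsgn_le[OF t] divide_right_mono[OF M(2)[OF t]]] m(1) m(2)[OF t, of x]
        order_trans[OF norm_ge_zero M(2)[OF t]]
      by (intro frac_le) auto
    finally show "norm (\<kappa> x) \<le> B" using B_ge by simp
    have "N x = ?F (ux t x, uxx t x, uxxx t x)" 
      by (simp only: N_eq \<kappa>x_def Let_def fst_conv snd_conv)
    moreover have "(ux t x, uxx t x, uxxx t x) \<in> ?K"
      using M[OF t, of x] m(2)[OF t, of x] by (simp add: not_less)
    ultimately show "norm (N x) \<le> B" using B2 B_ge by fastforce
    show "norm (V x) \<le> B" using B(1)[OF t, of x] B_ge unfolding w0_eq[OF t] by linarith
    show "norm (dsgn (ux t x) (w 1 t x)) \<le> B"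
      using dsgn_le[OF t, of x "w 1 t x"] divide_right_mono[OF B(2)[OF t, of x], of m] m(1) B_ge by simp
  qed (use m B_ge in auto)
qed

lemma u1_nonzero: "t \<in> {0..T'} \<Longrightarrow> ux t x \<noteq> 0"
  using immersed_curve.immersed[OF immersed_curve] by simp

definition weighted_energy :: "(real \<Rightarrow> real) \<Rightarrow> real \<Rightarrow> real \<Rightarrow> real" where
  "weighted_energy \<eta> R t = integral {-R..R} (\<lambda>x. \<eta> x * energy_density (ux t x) (uxx t x))"

lemma u_cont_x: "t \<in> {0..T'} \<Longrightarrow> continuous_on S (u b t)"
  by (intro continuous_at_imp_continuous_on ballI has_vector_derivative_continuous[OF u_deriv])

lemmas ux_cont_x = u_cont_x[where b = 1, unfolded u_eq] u_cont_x[where b = 2, unfolded u_eq]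

lemma w_cont_x: "t \<in> {0..T'} \<Longrightarrow> continuous_on S (w b t)"
  by (intro continuous_at_imp_continuous_on ballI has_vector_derivative_continuous[OF w_deriv])

lemma weighted_energy_deriv:
  assumes \<eta>: "continuous_on UNIV \<eta>" and t: "t \<in> {0..T'}"
  shows "(weighted_energy \<eta> R has_real_derivative integral {-R..R}
     (\<lambda>x. \<eta> x * energy_variation (ux t x) (uxx t x) (w 1 t x) (w 2 t x))) (at t within {0..T'})"
proof -
  let ?S = "{0..T'} \<times> {-R..R}"
  have c: "continuous_on ?S (\<lambda>p. u b (fst p) (snd p))" "continuous_on ?S (\<lambda>p. w b (fst p) (snd p))" for b
    using continuous_on_subset[OF u_cont, of ?S b] continuous_on_subset[OF w_cont, of ?S b]
    by (auto simp: split_def)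
  note c = c c(1)[of 1, unfolded u_eq] c(1)[of 2, unfolded u_eq]
  have \<eta>': "continuous_on ?S (\<lambda>p. \<eta> (snd p))"
    by (rule continuous_on_compose2[OF \<eta>]) (auto intro: continuous_intros)
  have cont: "continuous_on ?S (\<lambda>p. \<eta> (snd p) * energy_variation (ux (fst p) (snd p)) (uxx (fst p) (snd p))
      (w 1 (fst p) (snd p)) (w 2 (fst p) (snd p)))"
    using u1_nonzero by (intro continuous_intros \<eta>' c) auto
  have "((\<lambda>t. integral (cbox (-R) R) (\<lambda>x. \<eta> x * energy_density (ux t x) (uxx t x)))
     has_real_derivative integral (cbox (-R) R)
     (\<lambda>x. \<eta> x * energy_variation (ux t x) (uxx t x) (w 1 t x) (w 2 t x))) (at t within {0..T'})"
  proof (rule leibniz_rule_field_derivative)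
    show "((\<lambda>t. \<eta> x * energy_density (ux t x) (uxx t x)) has_real_derivative
      \<eta> x * energy_variation (ux t x) (uxx t x) (w 1 t x) (w 2 t x)) (at t within {0..T'})"
      if "t \<in> {0..T'}" for t x
      by (intro DERIV_cmult has_real_derivative_energy_density
          u_time_deriv[where b = 1, unfolded u_eq] u_time_deriv[where b = 2, unfolded u_eq] that u1_nonzero)
    show "(\<lambda>x. \<eta> x * energy_density (ux t x) (uxx t x)) integrable_on cbox (-R) R"
      if "t \<in> {0..T'}" for t
      using u1_nonzero[OF that]
      by (intro integrable_continuous continuous_intros ux_cont_x that continuous_on_subset[OF \<eta>]) auto
  qed (use cont t in \<open>auto simp: split_def\<close>)
  then show ?thesis by (simp add: weighted_energy_def[abs_def])
qed

text \<open>
  The pointwise inequality integrated over \<open>[-R, R]\<close>. The flux survives only at the two end points,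
  where it is of order \<open>\<delta>\<close>; the constants do not depend on \<open>R\<close>, \<open>\<delta>\<close> or the weight.
\<close>

lemma weighted_energy_growth:
  obtains C \<delta>0 where "0 \<le> C" "0 < \<delta>0"
    and "\<And>\<delta> \<eta> \<eta>' \<eta>'' R t. \<lbrakk> \<delta> \<le> \<delta>0; slowly_varying_weight \<delta> R \<eta> \<eta>' \<eta>''; t \<in> {0..T'} \<rbrakk> \<Longrightarrow>
      integral {-R..R} (\<lambda>x. \<eta> x * energy_variation (ux t x) (uxx t x) (w 1 t x) (w 2 t x))
      \<le> C * \<delta> * (1 + weighted_energy \<eta> R t) 
        - 1/2 * integral {-R..R} (\<lambda>x. \<eta> x * (norm (ux t x) * (w 0 t x \<bullet> w 0 t x)))"
proof -
  obtain m B where m: "0 < m" and B: "0 \<le> B"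
    and bd: "\<And>t x. t \<in> {0..T'} \<Longrightarrow> m \<le> norm (ux t x)"
      "\<And>t x. t \<in> {0..T'} \<Longrightarrow> norm (uxx t x) \<le> B"
      "\<And>t x. t \<in> {0..T'} \<Longrightarrow> norm (curvature (\<gamma> t) x) \<le> B"
      "\<And>t x. t \<in> {0..T'} \<Longrightarrow> norm (nabla_s (\<gamma> t) (curvature (\<gamma> t)) x) \<le> B"
      "\<And>t x. t \<in> {0..T'} \<Longrightarrow> norm (free_elastic_flow (\<gamma> t) x) \<le> B"
      "\<And>t x. t \<in> {0..T'} \<Longrightarrow> norm (dsgn (ux t x) (w 1 t x)) \<le> B"
    using geometric_bounds by blast
  define c0 where "c0 = 2 / m + (1 / m\<^sup>2 + B / m^3) / 2"
  define C1 where "C1 = (1 / m\<^sup>2 + B / m^3) + 4 / m + 2 * B\<^sup>2 / m"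
  define C2 where "C2 = 2 * B\<^sup>2 + 3 * B\<^sup>2 / m"
  have c0: "0 < c0" using m B unfolding c0_def by (intro add_pos_nonneg) auto
  have C12: "0 \<le> C1" "0 \<le> C2" using m B by (auto simp: C1_def C2_def)
  show thesis
  proof (rule that[of "C1 + 2 * C2" "min m (1 / (2 * c0))"])
    show "0 < min m (1 / (2 * c0))" "0 \<le> C1 + 2 * C2" using m c0 C12 by auto
  next
    fix \<delta> R t and \<eta> \<eta>' \<eta>'' :: "real \<Rightarrow> real"
    assume \<delta>_le: "\<delta> \<le> min m (1 / (2 * c0))" and t: "t \<in> {0..T'}"
      and "slowly_varying_weight \<delta> R \<eta> \<eta>' \<eta>''"
    then have \<delta>: "0 \<le> \<delta>" "\<delta> \<le> min m (1 / (2 * c0))" and R: "0 \<le> R"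
      and \<eta>: "\<And>x. (\<eta> has_real_derivative \<eta>' x) (at x)" "\<And>x. (\<eta>' has_real_derivative \<eta>'' x) (at x)"
      and wt: "\<And>x. x \<in> {-R..R} \<Longrightarrow> 0 \<le> \<eta> x \<and> \<eta> x \<le> 1 \<and> \<bar>\<eta>' x\<bar> \<le> \<delta> * \<eta> x \<and> \<bar>\<eta>'' x\<bar> \<le> \<delta> * \<eta> x"
      and ends: "\<eta> (-R) \<le> \<delta>" "\<eta> R \<le> \<delta>"
      by (auto simp: slowly_varying_weight_def)
    interpret immersed_curve "\<gamma> t" by (rule immersed_curve[OF t])
    have w0: "V = w 0 t" by (rule w0_eq[OF t, symmetric])
    have V_deriv: "(V has_vector_derivative w 1 t x) (at x)" for x
      using w_deriv[OF t, of 0 x] by (simp add: w0)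
    have w1_deriv: "(w 1 t has_vector_derivative w 2 t x) (at x)" for x
      using w_deriv[OF t, of 1 x] by (simp add: numeral_2_eq_2)
    have small: "\<delta> \<le> m" "\<delta> * c0 \<le> 1/2" using \<delta> c0 by (auto simp: field_simps)
    let ?flux = "flux (w 1 t) \<eta> \<eta>' (2 * \<delta> / m)"
    let ?ev = "\<lambda>x. \<eta> x * energy_variation (ux t x) (uxx t x) (w 1 t x) (w 2 t x)"
    let ?dis = "\<lambda>x. \<eta> x * (norm (ux t x) * (w 0 t x \<bullet> w 0 t x))"
    let ?en = "\<lambda>x. \<eta> x * energy_density (ux t x) (uxx t x)"
    have "\<forall>x\<in>{-R..R}. \<exists>f'. (?flux has_real_derivative f') (at x) \<and>
        ?ev x + 1/2 * ?dis x \<le> f' + \<delta> * C1 * ?en x"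
    proof
      fix x assume x: "x \<in> {-R..R}"
      have "\<kappa> x \<bullet> \<kappa> x \<le> B\<^sup>2"
        using bd(3)[OF t, of x] by (simp add: dot_square_norm power_mono)
      from flux_inequality[OF V_deriv w1_deriv \<eta> m _ _ this, of B \<delta>]
      show "\<exists>f'. (?flux has_real_derivative f') (at x) \<and> ?ev x + 1/2 * ?dis x \<le> f' + \<delta> * C1 * ?en x"
        using wt[OF x] small \<delta>(1) bd(1,2)[OF t, of x]
        by (simp add: w0 C1_def c0_def mult.assoc)
    qed
    then obtain f' where f': "\<And>x. x \<in> {-R..R} \<Longrightarrow> (?flux has_real_derivative f' x) (at x)"
      and le: "\<And>x. x \<in> {-R..R} \<Longrightarrow> ?ev x + 1/2 * ?dis x \<le> f' x + \<delta> * C1 * ?en x"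
      by metis
    have \<eta>_cont: "continuous_on {-R..R} \<eta>"
      by (rule DERIV_continuous_on) (rule has_field_derivative_at_within[OF \<eta>(1)])
    have "(f' has_integral (?flux R - ?flux (-R))) {-R..R}"
      by (rule fundamental_theorem_of_calculus)
        (use R f' in \<open>auto simp: has_real_derivative_iff_has_vector_derivative[symmetric]
          intro: has_field_derivative_at_within\<close>)
    moreover have "?en integrable_on {-R..R}" "?ev integrable_on {-R..R}" "?dis integrable_on {-R..R}"
      using u1_nonzero[OF t]
      by (intro integrable_continuous_interval continuous_intros \<eta>_cont ux_cont_x[OF t] w_cont_x[OF t]; simp)+
    note ints = this[THEN integrable_integral]
    ultimately have "integral {-R..R} ?ev + 1/2 * integral {-R..R} ?dis
        \<le> (?flux R - ?flux (-R)) + \<delta> * C1 * integral {-R..R} ?en"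
      by (intro has_integral_le[OF _ _ le] has_integral_add has_integral_mult_right ints)
    moreover have "\<bar>?flux x\<bar> \<le> \<delta> * C2" if "x = R \<or> x = - R" for x
    proof -
      have x: "x \<in> {-R..R}" using that R by auto
      show ?thesis
        unfolding C2_def
        by (rule flux_bound[OF V_deriv w1_deriv m _ B])
          (use bd[OF t, of x] wt[OF x] that ends \<delta> in auto)
    qed
    then have "\<bar>?flux R\<bar> \<le> \<delta> * C2" "\<bar>?flux (-R)\<bar> \<le> \<delta> * C2" by auto
    moreover have "0 \<le> weighted_energy \<eta> R t"
      unfolding weighted_energy_def
      by (intro integral_nonneg \<open>?en integrable_on _\<close>) (use wt in \<open>auto simp: energy_density_def\<close>)
    then have "0 \<le> \<delta> * C2 * weighted_energy \<eta> R t" "0 \<le> \<delta> * C1"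
      using \<delta> C12 by auto
    ultimately show "integral {-R..R} ?ev \<le> (C1 + 2 * C2) * \<delta> * (1 + weighted_energy \<eta> R t)
        - 1/2 * integral {-R..R} ?dis"
      by (simp add: weighted_energy_def algebra_simps)
  qed
qed

text \<open>
  The dissipation enters only through a lower bound \<open>c\<close>, which keeps the estimate free of double
  integrals; \<open>c = 0\<close> gives plain monotonicity up to \<open>O(\<delta>)\<close>.
\<close>

lemma weighted_energy_gronwall:
  obtains C \<delta>0 where "0 \<le> C" "0 < \<delta>0"
    and "\<And>\<delta> \<eta> \<eta>' \<eta>'' R s c. \<lbrakk> \<delta> \<le> \<delta>0; slowly_varying_weight \<delta> R \<eta> \<eta>' \<eta>''; s \<in> {0..T'}; 0 \<le> c;
      \<And>t. t \<in> {0..s} \<Longrightarrow> c \<le> integral {-R..R} (\<lambda>x. \<eta> x * (norm (ux t x) * (w 0 t x \<bullet> w 0 t x))) \<rbrakk>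
      \<Longrightarrow> weighted_energy \<eta> R s \<le> exp (C * \<delta> * s) * (weighted_energy \<eta> R 0 + C * \<delta> * s) - c / 2 * s"
proof (rule weighted_energy_growth)
  fix C \<delta>0
  assume C: "0 \<le> C" "0 < \<delta>0"
    and growth: "\<And>\<delta> \<eta> \<eta>' \<eta>'' R t. \<lbrakk> \<delta> \<le> \<delta>0; slowly_varying_weight \<delta> R \<eta> \<eta>' \<eta>''; t \<in> {0..T'} \<rbrakk> \<Longrightarrow>
      integral {-R..R} (\<lambda>x. \<eta> x * energy_variation (ux t x) (uxx t x) (w 1 t x) (w 2 t x))
      \<le> C * \<delta> * (1 + weighted_energy \<eta> R t) 
        - 1/2 * integral {-R..R} (\<lambda>x. \<eta> x * (norm (ux t x) * (w 0 t x \<bullet> w 0 t x)))"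
  show thesis
  proof (rule that[OF C])
    fix \<delta> R s c and \<eta> \<eta>' \<eta>'' :: "real \<Rightarrow> real"
    assume \<delta>_le: "\<delta> \<le> \<delta>0" and weight: "slowly_varying_weight \<delta> R \<eta> \<eta>' \<eta>''"
      and s: "s \<in> {0..T'}" and c: "0 \<le> c"
      and dis: "\<And>t. t \<in> {0..s} \<Longrightarrow> c \<le> integral {-R..R} (\<lambda>x. \<eta> x * (norm (ux t x) * (w 0 t x \<bullet> w 0 t x)))"
    define F where "F = weighted_energy \<eta> R"
    define F' where "F' t = integral {-R..R} (\<lambda>x. \<eta> x * energy_variation (ux t x) (uxx t x) (w 1 t x) (w 2 t x))" for t
    define k where "k = C * \<delta>"
    have k: "0 \<le> k" using C weight by (simp add: k_def slowly_varying_weight_def)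
    have \<eta>_cont: "continuous_on UNIV \<eta>"
      using weight unfolding slowly_varying_weight_def
      by (intro continuous_at_imp_continuous_on ballI) (metis DERIV_isCont)
    have F_deriv: "(F has_real_derivative F' t) (at t within {0..T'})" if "t \<in> {0..T'}" for t
      unfolding F_def F'_def by (rule weighted_energy_deriv[OF \<eta>_cont that])
    have F'_le: "F' t \<le> k + k * F t - c / 2" if "t \<in> {0..s}" for t
      using growth[OF \<delta>_le weight, of t] dis[OF that] that s
      unfolding F_def[symmetric] F'_def[symmetric] k_def[symmetric] by (simp add: distrib_left)
    (* G is nonincreasing: the Gronwall factor removes k F, the linear terms absorb the flux
       and half of the dissipation *)
    define G where "G t = exp (- k * t) * F t - k * t + c / 2 * exp (- k * s) * t" for t
    have G_deriv: "(G has_real_derivative exp (- k * t) * (F' t - k * F t) - k + c / 2 * exp (- k * s))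
        (at t within {0..T'})" if "t \<in> {0..T'}" for t
      unfolding G_def[abs_def]
      by (auto intro!: derivative_eq_intros F_deriv[OF that] simp: algebra_simps)
    have "G 0 \<ge> G s"
    proof (rule DERIV_nonpos_imp_decreasing_open[where f = G and a = 0 and b = s])
      show "0 \<le> s" using s by simp
      have "continuous_on {0..T'} G"
        using G_deriv by (rule DERIV_continuous_on)
      then show "continuous_on {0..s} G" by (rule continuous_on_subset) (use s in auto)
      fix t assume t: "0 < t" "t < s"
      then have "at t within {0..T'} = at t" using s by (intro at_within_Icc_at) auto
      then have "(G has_real_derivative exp (- k * t) * (F' t - k * F t) - k + c / 2 * exp (- k * s)) (at t)"
        using G_deriv[of t] t s by auto
      moreover have "exp (- k * t) * (F' t - k * F t) - k + c / 2 * exp (- k * s) \<le> 0"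
      proof -
        have "exp (- k * t) * (F' t - k * F t) \<le> exp (- k * t) * (k - c / 2)"
          using F'_le[of t] t by (intro mult_left_mono) auto
        also have "\<dots> = exp (- k * t) * k - exp (- k * t) * (c / 2)" by (simp add: algebra_simps)
        also have "\<dots> \<le> 1 * k - exp (- k * s) * (c / 2)"
          using k t c by (intro diff_mono mult_right_mono) (auto simp: mult_left_mono)
        finally show ?thesis by (simp add: algebra_simps)
      qed
      ultimately show "\<exists>y. (G has_real_derivative y) (at t) \<and> y \<le> 0" by blast
    qed
    then have "exp (- k * s) * F s \<le> F 0 + k * s - c / 2 * exp (- k * s) * s"
      by (simp add: G_def)
    then have "exp (k * s) * (exp (- k * s) * F s)
        \<le> exp (k * s) * (F 0 + k * s - c / 2 * exp (- k * s) * s)"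
      by (intro mult_left_mono) auto
    moreover have "exp (k * s) * (exp (- k * s) * F s) = (exp (k * s) * exp (- k * s)) * F s"
      by (simp only: mult.assoc)
    moreover have "exp (k * s) * (F 0 + k * s - c / 2 * exp (- k * s) * s)
        = exp (k * s) * (F 0 + k * s) - (exp (k * s) * exp (- k * s)) * (c / 2 * s)"
      by (simp only: right_diff_distrib mult_ac)
    moreover have "exp (k * s) * exp (- k * s) = 1" by (simp add: exp_add[symmetric])
    ultimately have "1 * F s \<le> exp (k * s) * (F 0 + k * s) - 1 * (c / 2 * s)" by metis
    then show "weighted_energy \<eta> R s \<le> exp (C * \<delta> * s) * (weighted_energy \<eta> R 0 + C * \<delta> * s) - c / 2 * s"
      unfolding F_def[symmetric] k_def[symmetric] by simp
  qed
qed

end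

section \<open>The energy inequality\<close>

text \<open>
  On \<open>[-N\<^sup>3, N\<^sup>3]\<close> the Gaussian of width \<open>N\<^sup>2\<close> has logarithmic derivative at most \<open>2 / N\<close>, and at the end
  points it is \<open>exp (- N\<^sup>2)\<close>. Thus \<open>\<delta>\<close> tends to \<open>0\<close> although the interval outgrows the width.
\<close>

lemma gaussian_weight:
  fixes N :: real
  assumes "1 \<le> N"
  defines "\<eta> \<equiv> \<lambda>x. exp (- x\<^sup>2 / N^4)"
  defines "\<eta>' \<equiv> \<lambda>x. - 2 * x / N^4 * \<eta> x"
  defines "\<eta>'' \<equiv> \<lambda>x. (4 * x\<^sup>2 / N^8 - 2 / N^4) * \<eta> x"
  shows "slowly_varying_weight (6 / N) (N^3) \<eta> \<eta>' \<eta>''"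
proof -
  have N: "0 < N" using assms by simp
  have d: "(\<eta> has_real_derivative \<eta>' x) (at x)" for x
    unfolding \<eta>_def \<eta>'_def using N
    by (auto intro!: derivative_eq_intros simp: field_simps simp flip: power_add)
  have d': "(\<eta>' has_real_derivative \<eta>'' x) (at x)" for x
    unfolding \<eta>'_def \<eta>''_def
    by (rule DERIV_cong[OF DERIV_mult[OF DERIV_cdivide[OF DERIV_cmult_Id] d]])
       (use N in \<open>simp add: \<eta>'_def field_simps power2_eq_square power_add[symmetric]\<close>)
  have pow: "1 / N^2 \<le> 1 / N" "1 / N^4 \<le> 1 / N"
    using assms(1) power_increasing[of 1 2 N] power_increasing[of 1 4 N]
    by (auto intro!: divide_left_mono)
  have bounds: "0 \<le> \<eta> x \<and> \<eta> x \<le> 1 \<and> \<bar>\<eta>' x\<bar> \<le> 6 / N * \<eta> x \<and> \<bar>\<eta>'' x\<bar> \<le> 6 / N * \<eta> x"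
    if "x \<in> {-(N^3)..N^3}" for x
  proof (intro conjI)
    have x: "\<bar>x\<bar> \<le> N^3" using that by auto
    show \<eta>0: "0 \<le> \<eta> x" by (simp add: \<eta>_def)
    show "\<eta> x \<le> 1" using N by (simp add: \<eta>_def)
    have "\<bar>x\<bar> / N^4 \<le> N^3 / N^4" using x N by (intro divide_right_mono) auto
    also have "\<dots> = 1 / N" using N by (simp add: power_eq_if)
    finally have a: "\<bar>x\<bar> / N^4 \<le> 1 / N" .
    have "\<bar>\<eta>' x\<bar> = 2 * (\<bar>x\<bar> / N^4) * \<eta> x" using N \<eta>0 by (simp add: \<eta>'_def abs_mult)
    also have "\<dots> \<le> (6 / N) * \<eta> x"
    proof (rule mult_right_mono[OF _ \<eta>0])
      have "2 * (1 / N) \<le> 6 / N" using N by (simp add: divide_right_mono)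
      with a show "2 * (\<bar>x\<bar> / N^4) \<le> 6 / N" by linarith
    qed
    finally show "\<bar>\<eta>' x\<bar> \<le> 6 / N * \<eta> x" .
    have "x\<^sup>2 / N^8 = (\<bar>x\<bar> / N^4)\<^sup>2" by (simp add: power_divide flip: power_mult)
    also have "\<dots> \<le> (1 / N)\<^sup>2" using a N by (intro power_mono) auto
    finally have "x\<^sup>2 / N^8 \<le> 1 / N" using pow by (simp add: power_divide)
    moreover have "0 \<le> x\<^sup>2 / N^8" "0 \<le> 1 / N^4" using N by auto
    moreover have "4 * x\<^sup>2 / N^8 = 4 * (x\<^sup>2 / N^8)" "2 / N^4 = 2 * (1 / N^4)" "6 / N = 6 * (1 / N)"
      by simp_all
    ultimately have "\<bar>4 * x\<^sup>2 / N^8 - 2 / N^4\<bar> \<le> 6 / N"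
      using pow by linarith
    then show "\<bar>\<eta>'' x\<bar> \<le> 6 / N * \<eta> x"
      unfolding \<eta>''_def abs_mult abs_of_nonneg[OF \<eta>0] by (rule mult_right_mono[OF _ \<eta>0])
  qed
  have "N \<le> exp N" using exp_ge_add_one_self[of N] by linarith
  also have "exp N \<le> exp (N^2)" using assms(1) by (simp add: power2_eq_square)
  finally have "inverse (exp (N^2)) \<le> 1 / N" using N by (simp add: field_simps)
  moreover have "(N^3)\<^sup>2 / N^4 = N^2" using N by (simp add: field_simps flip: power_mult power_add)
  then have "\<eta> (N^3) = inverse (exp (N^2))" "\<eta> (-(N^3)) = inverse (exp (N^2))"
    by (simp_all only: \<eta>_def power2_minus minus_divide_left[symmetric] exp_minus)
  ultimately have "\<eta> (-(N^3)) \<le> 6 / N" "\<eta> (N^3) \<le> 6 / N"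
    using divide_right_mono[of 1 6 N] N by linarith+
  then show ?thesis
    unfolding slowly_varying_weight_def using N d d' bounds by auto
qed

context elastic_flow
begin

text \<open>
  As \<open>N \<rightarrow> \<infinity>\<close> the weights tend to \<open>1\<close> on every fixed interval \<open>[-M, M]\<close> and the weighted initial
  energies stay below \<open>B\<close>. The Gronwall factor and the flux errors tend to their
  values at \<open>\<delta> = 0\<close>.
\<close>

lemma energy_inequality:
  assumes s: "s \<in> {0..T'}" and c: "0 \<le> c" "0 \<le> L"
    and dissipation: "\<And>t. t \<in> {0..s} \<Longrightarrow> c \<le> integral {-L..L} (\<lambda>x. norm (ux t x) * (w 0 t x \<bullet> w 0 t x))"
    and initial_energy: "\<And>R. 0 \<le> R \<Longrightarrow> integral {-R..R} (\<lambda>x. energy_density (ux 0 x) (uxx 0 x)) \<le> B"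
    and M: "0 \<le> M"
  shows "integral {-M..M} (\<lambda>x. energy_density (ux s x) (uxx s x)) \<le> B - c / 2 * s"
proof (rule weighted_energy_gronwall)
  fix C \<delta>0
  assume C: "0 \<le> C" "0 < \<delta>0"
    and gronwall: "\<And>\<delta> \<eta> \<eta>' \<eta>'' R s c. \<lbrakk> \<delta> \<le> \<delta>0; slowly_varying_weight \<delta> R \<eta> \<eta>' \<eta>''; s \<in> {0..T'}; 0 \<le> c;
      \<And>t. t \<in> {0..s} \<Longrightarrow> c \<le> integral {-R..R} (\<lambda>x. \<eta> x * (norm (ux t x) * (w 0 t x \<bullet> w 0 t x))) \<rbrakk>
      \<Longrightarrow> weighted_energy \<eta> R s \<le> exp (C * \<delta> * s) * (weighted_energy \<eta> R 0 + C * \<delta> * s) - c / 2 * s"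
  let ?\<eta> = "\<lambda>N x::real. exp (- x\<^sup>2 / N^4)"
  let ?e = "\<lambda>t x. energy_density (ux t x) (uxx t x)"
  let ?v = "\<lambda>t x. norm (ux t x) * (w 0 t x \<bullet> w 0 t x)"
  have \<eta>_cont: "continuous_on S (?\<eta> N)" if "1 \<le> N" for N :: real and S
    using that by (intro continuous_intros) auto
  have e_cont: "continuous_on S (?e t)" "continuous_on S (?v t)" if "t \<in> {0..T'}" for S t
    using u1_nonzero[OF that] by (intro continuous_intros ux_cont_x[OF that] w_cont_x[OF that]; simp)+
  have e_nonneg: "0 \<le> ?e t x" "0 \<le> ?v t x" for t x by (auto simp: energy_density_def)
  have lower: "?\<eta> N L * integral {-L..L} f \<le> integral {-R..R} (\<lambda>x. ?\<eta> N x * f x)"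
    if "1 \<le> N" "0 \<le> L" "L \<le> R" and f: "continuous_on UNIV f" "\<And>x. 0 \<le> f x"
    for N L R and f :: "real \<Rightarrow> real"
  proof -
    have int: "(\<lambda>x. ?\<eta> N x * f x) integrable_on {-r..r}" for r
      by (intro integrable_continuous_interval continuous_on_mult \<eta>_cont that continuous_on_subset[OF f(1)]) auto
    have "?\<eta> N L * integral {-L..L} f = integral {-L..L} (\<lambda>x. ?\<eta> N L * f x)" by simp
    also have "\<dots> \<le> integral {-L..L} (\<lambda>x. ?\<eta> N x * f x)"
    proof (rule integral_le)
      show "(\<lambda>x. ?\<eta> N L * f x) integrable_on {-L..L}"
        by (intro integrable_continuous_interval continuous_intros continuous_on_subset[OF f(1)]) auto
      fix x assume "x \<in> {-L..L}"
      then have "x\<^sup>2 \<le> L\<^sup>2" by (simp add: abs_le_square_iff[symmetric] abs_le_iff)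
      then show "?\<eta> N L * f x \<le> ?\<eta> N x * f x"
        using that by (intro mult_right_mono f) (simp add: divide_right_mono)
    qed (rule int)
    also have "\<dots> \<le> integral {-R..R} (\<lambda>x. ?\<eta> N x * f x)"
      by (intro integral_subset_le int) (use that in auto)
    finally show ?thesis .
  qed
  have est: "?\<eta> N M * integral {-M..M} (?e s)
      \<le> exp (C * (6 / N) * s) * (B + C * (6 / N) * s) - ?\<eta> N L * c / 2 * s"
    if N: "1 \<le> N" "6 / \<delta>0 \<le> N" "M \<le> N" "L \<le> N" for N :: real
  proof -
    have N3: "N \<le> N^3" using power_increasing[of 1 3 N] N by simp
    let ?R = "N^3"
    have 0: "0 \<in> {0..T'}" using T'_pos by simp
    have "?\<eta> N M * integral {-M..M} (?e s) \<le> weighted_energy (?\<eta> N) ?R s"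
      unfolding weighted_energy_def using N N3 M
      by (intro lower e_cont[OF s] e_nonneg) auto
    also have "\<dots> \<le> exp (C * (6 / N) * s) * (weighted_energy (?\<eta> N) ?R 0 + C * (6 / N) * s) - (?\<eta> N L * c) / 2 * s"
    proof (rule gronwall[OF _ gaussian_weight[OF N(1)] s])
      show "6 / N \<le> \<delta>0" using N C by (simp add: field_simps)
      fix t assume t: "t \<in> {0..s}"
      then have t': "t \<in> {0..T'}" using s by auto
      have "?\<eta> N L * c \<le> ?\<eta> N L * integral {-L..L} (?v t)"
        using dissipation[OF t] by (intro mult_left_mono) auto
      also have "\<dots> \<le> integral {-?R..?R} (\<lambda>x. ?\<eta> N x * ?v t x)"
        using N N3 c by (intro lower e_cont[OF t'] e_nonneg) auto
      finally show "?\<eta> N L * c \<le> integral {-?R..?R} (\<lambda>x. ?\<eta> N x * ?v t x)" .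
    qed (use N c in auto)
    also have "weighted_energy (?\<eta> N) ?R 0 \<le> integral {-?R..?R} (?e 0)"
      unfolding weighted_energy_def
    proof (rule integral_le)
      show "(\<lambda>x. ?\<eta> N x * ?e 0 x) integrable_on {-?R..?R}" "?e 0 integrable_on {-?R..?R}"
        by (intro integrable_continuous_interval continuous_on_mult \<eta>_cont N e_cont[OF 0])+
      show "?\<eta> N x * ?e 0 x \<le> ?e 0 x" for x
        using N e_nonneg(1)[of 0 x] by (intro mult_left_le_one_le) auto
    qed
    also have "\<dots> \<le> B" using N by (intro initial_energy) auto
    finally show ?thesis by simp
  qed
  have lim: "((\<lambda>N. ?\<eta> N r) \<longlongrightarrow> 1) at_top" for r :: real
  proof -
    have "((\<lambda>N. exp (- r\<^sup>2 / N^4)) \<longlongrightarrow> exp 0) at_top"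
      by (intro tendsto_exp tendsto_divide_0[OF tendsto_const] filterlim_at_top_imp_at_infinity
          filterlim_pow_at_top filterlim_ident) simp
    then show ?thesis by simp
  qed
  have "((\<lambda>N. ?\<eta> N M * integral {-M..M} (?e s)) \<longlongrightarrow> 1 * integral {-M..M} (?e s)) at_top"
    by (intro tendsto_intros lim)
  moreover have "((\<lambda>N. exp (C * (6 / N) * s) * (B + C * (6 / N) * s) - ?\<eta> N L * c / 2 * s)
      \<longlongrightarrow> exp (C * 0 * s) * (B + C * 0 * s) - 1 * c / 2 * s) at_top"
    by (intro tendsto_intros lim tendsto_divide_0[OF tendsto_const] filterlim_at_top_imp_at_infinity filterlim_ident) auto
  moreover have "\<forall>\<^sub>F N in at_top. ?\<eta> N M * integral {-M..M} (?e s)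
      \<le> exp (C * (6 / N) * s) * (B + C * (6 / N) * s) - ?\<eta> N L * c / 2 * s"
    using eventually_ge_at_top[of 1] eventually_ge_at_top[of "6 / \<delta>0"]
      eventually_ge_at_top[of M] eventually_ge_at_top[of L]
    by eventually_elim (rule est)
  ultimately have "1 * integral {-M..M} (?e s) \<le> exp (C * 0 * s) * (B + C * 0 * s) - 1 * c / 2 * s"
    by - (rule tendsto_le[OF trivial_limit_at_top_linorder])
  then show ?thesis by simp
qed

end

section \<open>Isometric curves\<close>

lemma energy_density_normal_part:
  "energy_density a b = (normal_part a b \<bullet> normal_part a b) / (2 * norm a ^ 3)"
  by (cases "a = 0") (simp_all add: energy_density_def dsgn_def field_simps power3_eq_cube)

text \<open>
  For \<open>\<gamma> = p + a L (\<eta> \<circ> \<phi>)\<close> the derivatives \<open>\<gamma>\<^sub>x\<close> and \<open>\<gamma>\<^sub>x\<^sub>x\<close> have the form on the left, with \<open>k = a \<phi>'\<close>,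
  \<open>d = a \<phi>'\<^sup>2\<close>. The tangential contribution of \<open>\<phi>''\<close> drops out, and so does the sign of \<open>\<phi>'\<close>, which is why
  orientation-reversing reparametrizations need no separate treatment.
\<close>

lemma energy_density_similarity:
  assumes L: "orthogonal_transformation L" and a: "a \<noteq> 0" and k: "k \<noteq> 0"
  shows "energy_density (k *\<^sub>R L a) (c *\<^sub>R L a + d *\<^sub>R L b) = d\<^sup>2 / \<bar>k\<bar>^3 * energy_density a b"
proof -
  have lin: "linear L" using L by (rule orthogonal_transformation_linear)
  have norm: "norm (L v) = norm v" for v using L by (rule orthogonal_transformation_norm)
  have ip: "L v \<bullet> L w = v \<bullet> w" for v w using L by (simp add: orthogonal_transformation_def)
  have sgnL: "sgn (L a) = L (sgn a)" by (simp add: sgn_div_norm norm linear_scale[OF lin])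
  have "sgn (k *\<^sub>R L a) = sgn k *\<^sub>R L (sgn a)" by (simp add: sgn_scaleR sgnL)
  moreover have "sgn k * sgn k = 1" using k by (simp add: sgn_if)
  ultimately have np: "normal_part (k *\<^sub>R L a) v = v - (v \<bullet> L (sgn a)) *\<^sub>R L (sgn a)" for v
    by (simp add: normal_part_def mult.assoc[symmetric] mult.commute[of "sgn k"] mult.left_commute[of "sgn k"])
  have "a \<bullet> sgn a = norm a"
    using a by (simp add: sgn_div_norm dot_square_norm power2_eq_square)
  moreover have "a = norm a *\<^sub>R sgn a" using a by (simp add: sgn_div_norm)
  then have "L a = norm a *\<^sub>R L (sgn a)" by (metis lin linear_scale)
  ultimately have "normal_part (k *\<^sub>R L a) (c *\<^sub>R L a + d *\<^sub>R L b) = d *\<^sub>R (L b - (b \<bullet> sgn a) *\<^sub>R L (sgn a))"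
    unfolding np by (simp add: inner_add_left ip sgn_unit[OF a] algebra_simps)
  also have "\<dots> = d *\<^sub>R L (normal_part a b)"
    by (simp add: normal_part_def linear_diff[OF lin] linear_scale[OF lin])
  finally show ?thesis
    by (simp add: energy_density_normal_part ip norm power_mult_distrib power2_eq_square)
qed

lemma energy_density_isometric:
  fixes \<gamma> \<eta> :: "real \<Rightarrow> 'a::euclidean_space"
  assumes \<eta>: "smooth \<eta>" "\<And>x. D \<eta> x \<noteq> 0" and a: "0 < a"
    and iso: "isometric_curves \<gamma> (\<lambda>x. a *\<^sub>R \<eta> x)"
  obtains \<phi> \<phi>' where "bij \<phi>" "\<And>x. (\<phi> has_real_derivative \<phi>' x) (at x)"
    and "\<And>x. energy_density (D \<gamma> x) (D (D \<gamma>) x)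
      = (1 / a) * (\<bar>\<phi>' x\<bar> * energy_density (D \<eta> (\<phi> x)) (D (D \<eta>) (\<phi> x)))"
proof -
  obtain F \<phi> where F: "\<And>p q. dist (F p) (F q) = dist p q" and \<phi>: "reparametrization \<phi>"
    and \<gamma>: "\<gamma> = F \<circ> (\<lambda>x. a *\<^sub>R \<eta> x) \<circ> \<phi>"
    using iso unfolding isometric_curves_def by blast
  define L where "L p = F p - F 0" for p
  have L: "orthogonal_transformation L"
    using F by (simp add: orthogonal_transformation_isometry L_def dist_norm)
  then have lin: "linear L" by (rule orthogonal_transformation_linear)
  then have bl: "bounded_linear L" by (simp add: linear_conv_bounded_linear)
  have sm: "smooth \<phi>" and bij: "bij \<phi>" and ne: "\<And>x. D \<phi> x \<noteq> 0"
    using \<phi> by (auto simp: reparametrization_def)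
  have \<phi>1: "(\<phi> has_real_derivative D \<phi> x) (at x)" for x
    using smooth_has_vector_derivative[OF sm, of 0]
    by (simp add: has_real_derivative_iff_has_vector_derivative)
  have \<phi>2: "(D \<phi> has_real_derivative D (D \<phi>) x) (at x)" for x
    using smooth_has_vector_derivative[OF sm, of 1]
    by (simp add: has_real_derivative_iff_has_vector_derivative)
  note \<phi>1v = \<phi>1[unfolded has_real_derivative_iff_has_vector_derivative]
  have \<eta>1: "(\<eta> has_vector_derivative D \<eta> x) (at x)" for x
    using smooth_has_vector_derivative[OF \<eta>(1), of 0] by simp
  have \<eta>2: "(D \<eta> has_vector_derivative D (D \<eta>) x) (at x)" for x
    using smooth_has_vector_derivative[OF \<eta>(1), of 1] by simp
  have c1: "((\<lambda>x. \<eta> (\<phi> x)) has_vector_derivative D \<phi> x *\<^sub>R D \<eta> (\<phi> x)) (at x)" for x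
    using vector_diff_chain_at[OF \<phi>1v \<eta>1] by (simp add: o_def)
  have c2: "((\<lambda>x. D \<eta> (\<phi> x)) has_vector_derivative D \<phi> x *\<^sub>R D (D \<eta>) (\<phi> x)) (at x)" for x
    using vector_diff_chain_at[OF \<phi>1v \<eta>2] by (simp add: o_def)
  have \<gamma>_eq: "\<gamma> = (\<lambda>x. F 0 + a *\<^sub>R L (\<eta> (\<phi> x)))"
  proof
    fix x
    have "a *\<^sub>R L (\<eta> (\<phi> x)) = L (a *\<^sub>R \<eta> (\<phi> x))" by (simp add: linear_scale[OF lin])
    then show "\<gamma> x = F 0 + a *\<^sub>R L (\<eta> (\<phi> x))" by (simp add: \<gamma> L_def)
  qed
  have d1: "(\<gamma> has_vector_derivative (a * D \<phi> x) *\<^sub>R L (D \<eta> (\<phi> x))) (at x)" for x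
  proof -
    have "((\<lambda>x. F 0 + a *\<^sub>R L (\<eta> (\<phi> x))) has_vector_derivative
        0 + a *\<^sub>R L (D \<phi> x *\<^sub>R D \<eta> (\<phi> x))) (at x)"
      by (intro has_vector_derivative_add has_vector_derivative_const
          bounded_linear.has_vector_derivative[OF bounded_linear_scaleR_right]
          bounded_linear.has_vector_derivative[OF bl] c1)
    then show ?thesis by (simp add: \<gamma>_eq linear_scale[OF lin])
  qed
  then have D1: "D \<gamma> = (\<lambda>x. (a * D \<phi> x) *\<^sub>R L (D \<eta> (\<phi> x)))" by (intro ext D_eqI)
  have d2: "((\<lambda>x. (a * D \<phi> x) *\<^sub>R L (D \<eta> (\<phi> x))) has_vector_derivative
      ((a * D \<phi> x) *\<^sub>R L (D \<phi> x *\<^sub>R D (D \<eta>) (\<phi> x)) + (a * D (D \<phi>) x) *\<^sub>R L (D \<eta> (\<phi> x)))) (at x)" for x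
    by (intro has_vector_derivative_scaleR DERIV_cmult \<phi>2 bounded_linear.has_vector_derivative[OF bl] c2)
  have D2: "D (D \<gamma>) x = (a * D (D \<phi>) x) *\<^sub>R L (D \<eta> (\<phi> x)) + (a * (D \<phi> x)\<^sup>2) *\<^sub>R L (D (D \<eta>) (\<phi> x))" for x
    unfolding D1 D_eqI[OF d2] by (simp add: linear_scale[OF lin] power2_eq_square)
  show thesis
  proof (rule that[OF bij \<phi>1])
    fix x
    have "(a * p\<^sup>2)\<^sup>2 / (a * p)^3 = (1 / a) * p" if "0 < p" for p
      using a that by (simp add: field_simps power2_eq_square power3_eq_cube)
    from this[of "\<bar>D \<phi> x\<bar>"]
    have "(a * (D \<phi> x)\<^sup>2)\<^sup>2 / \<bar>a * D \<phi> x\<bar>^3 = (1 / a) * \<bar>D \<phi> x\<bar>"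
      using a ne[of x] by (simp add: abs_mult)
    then show "energy_density (D \<gamma> x) (D (D \<gamma>) x)
      = (1 / a) * (\<bar>D \<phi> x\<bar> * energy_density (D \<eta> (\<phi> x)) (D (D \<eta>) (\<phi> x)))"
      unfolding D2 unfolding D1
      by (subst energy_density_similarity[OF L]) (use a ne \<eta> in auto)
  qed
qed

abbreviation "curve_density \<gamma> x \<equiv> energy_density (D \<gamma> x) (D (D \<gamma>) x)"

lemma curve_density_nonneg: "0 \<le> curve_density \<gamma> x"
  by (simp add: energy_density_def)

text \<open>
  The bending energy is inversely proportional to the scale.
\<close>

lemma isometric_has_integral:
  fixes \<gamma> \<eta> :: "real \<Rightarrow> 'a::euclidean_space"
  assumes "smooth \<eta>" "\<And>x. D \<eta> x \<noteq> 0" "0 < a" "isometric_curves \<gamma> (\<lambda>x. a *\<^sub>R \<eta> x)"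
    and E: "(curve_density \<eta> has_integral E) UNIV"
  shows "(curve_density \<gamma> has_integral (1 / a) * E) UNIV"
proof (rule energy_density_isometric[OF assms(1-4)])
  fix \<phi> \<phi>' :: "real \<Rightarrow> real"
  assume \<phi>: "bij \<phi>" "\<And>x. (\<phi> has_real_derivative \<phi>' x) (at x)"
    and eq: "\<And>x. curve_density \<gamma> x = (1 / a) * (\<bar>\<phi>' x\<bar> * curve_density \<eta> (\<phi> x))"
  have "curve_density \<eta> absolutely_integrable_on \<phi> ` UNIV \<and> integral (\<phi> ` UNIV) (curve_density \<eta>) = E"
    using E bij_is_surj[OF \<phi>(1)] curve_density_nonneg[of \<eta>]
    by (auto intro!: nonnegative_absolutely_integrable_1 simp: integral_unique)
  then have "(\<lambda>x. \<bar>\<phi>' x\<bar> * curve_density \<eta> (\<phi> x)) absolutely_integrable_on UNIV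
      \<and> integral UNIV (\<lambda>x. \<bar>\<phi>' x\<bar> * curve_density \<eta> (\<phi> x)) = E"
    by (subst has_absolute_integral_change_of_variables_1') (auto intro: \<phi> bij_is_inj)
  then have "((\<lambda>x. \<bar>\<phi>' x\<bar> * curve_density \<eta> (\<phi> x)) has_integral E) UNIV"
    using set_lebesgue_integral_eq_integral(1) by blast
  from has_integral_mult_right[OF this, of "1 / a"] show ?thesis by (simp add: eq)
qed

section \<open>Curves of finite energy\<close>

lemma has_integral_UNIV_le:
  fixes f :: "real \<Rightarrow> real"
  assumes "(f has_integral i) UNIV" and "\<And>M. 0 \<le> M \<Longrightarrow> integral {-M..M} f \<le> b"
  shows "i \<le> b"
proof (rule ccontr)
  assume "\<not> i \<le> b"
  then have "0 < i - b" by simp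
  moreover have "\<forall>e>0. \<exists>B>0. \<forall>a b'. ball 0 B \<subseteq> cbox a b' \<longrightarrow> norm (integral (cbox a b') f - i) < e"
    using assms(1) unfolding has_integral_alt'[of f i UNIV] by simp
  ultimately obtain B where B: "0 < B"
    "\<And>a b'. ball 0 B \<subseteq> cbox a b' \<Longrightarrow> norm (integral (cbox a b') f - i) < i - b"
    by blast
  have "ball 0 B \<subseteq> cbox (-B) B" by (auto simp: dist_norm)
  from B(2)[OF this] assms(2)[of B] B(1) show False by simp
qed

context immersed_curve
begin

lemma density_cont: "continuous_on S (curve_density \<gamma>)"
  by (intro continuous_intros continuous_at_imp_continuous_on ballI has_vector_derivative_continuous[OF u1_deriv]
      has_vector_derivative_continuous[OF u2_deriv] immersed)

lemma bending_energy_eq: "bending_energy \<gamma> = (\<integral>\<^sup>+ x. ennreal (curve_density \<gamma> x) \<partial>lborel)"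
proof -
  have "curve_density \<gamma> \<in> borel_measurable borel"
    by (rule borel_measurable_continuous_onI[OF density_cont])
  then have "(\<integral>\<^sup>+ x. ennreal (1 / 2) * ennreal (2 * curve_density \<gamma> x) \<partial>lborel)
      = ennreal (1 / 2) * (\<integral>\<^sup>+ x. ennreal (2 * curve_density \<gamma> x) \<partial>lborel)"
    by (intro nn_integral_cmult) auto
  moreover have "ennreal (1 / 2) * ennreal (2 * curve_density \<gamma> x) = ennreal (curve_density \<gamma> x)" for x
    by (subst ennreal_mult[symmetric]) (simp_all add: curve_density_nonneg)
  moreover have "2 * curve_density \<gamma> x = (norm (\<kappa> x))\<^sup>2 * norm (D \<gamma> x)" for x
    by (simp add: energy_density_eq dot_square_norm)
  moreover have "ennreal (1 / 2) = 1 / 2"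
    using divide_ennreal[of 1 2] by simp
  ultimately show ?thesis unfolding bending_energy_def by simp
qed

lemma finite_bending_energy:
  assumes "bending_energy \<gamma> < \<infinity>"
  obtains E where "(curve_density \<gamma> has_integral E) UNIV"
    and "\<And>R. integral {-R..R} (curve_density \<gamma>) \<le> E"
proof -
  have "curve_density \<gamma> \<in> borel_measurable lborel"
    using borel_measurable_continuous_onI[OF density_cont] by simp
  then have "integrable lborel (curve_density \<gamma>)"
    using assms unfolding bending_energy_eq
    by (intro integrableI_nonneg) (auto simp: curve_density_nonneg)
  then have "(curve_density \<gamma> has_integral (integral\<^sup>L lborel (curve_density \<gamma>))) UNIV"
    by (rule has_integral_integral_lborel)
  then have i: "(curve_density \<gamma> has_integral (integral UNIV (curve_density \<gamma>))) UNIV"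
    by (rule has_integral_integrable_integral[THEN iffD1, THEN conjunct1, THEN integrable_integral])
  show thesis
    by (rule that[OF i]) (use i in \<open>auto intro!: integral_subset_le integrable_continuous_interval
        density_cont simp: curve_density_nonneg\<close>)
qed

lemma zero_energy_flat:
  assumes "\<And>R. integral {-R..R} (curve_density \<gamma>) \<le> 0"
  shows "\<kappa> x = 0"
proof -
  let ?R = "\<bar>x\<bar> + 1"
  have "0 \<le> integral {-?R..?R} (curve_density \<gamma>)"
    by (intro integral_nonneg integrable_continuous_interval density_cont curve_density_nonneg)
  then have "integral {-?R..?R} (curve_density \<gamma>) = 0" using assms[of ?R] by simp
  then have "\<forall>y\<in>{-?R..?R}. curve_density \<gamma> y = 0"
    by (subst (asm) integral_eq_0_iff) (auto simp: curve_density_nonneg density_cont)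
  then have "curve_density \<gamma> x = 0" by (rule bspec) auto
  then show ?thesis using immersed[of x] by (simp add: energy_density_eq)
qed

text \<open>
  The first integral \<open>c\<close> of the free elastica equation bounds \<open>\<kappa>\<close> and \<open>\<nabla>\<^sub>s \<kappa>\<close>. If \<open>c > 0\<close>, then over
  \<open>[-R, R]\<close>, whose length is at least \<open>2 R m\<close>, the increment of \<open>\<langle>\<kappa>, \<nabla>\<^sub>s \<kappa>\<rangle>\<close> is at least
  \<open>2 R m c\<close> minus a multiple of the energy, which is impossible for large \<open>R\<close>.
\<close>

lemma free_elastica_flat:
  assumes V: "\<And>x. V x = 0" and m: "0 < m" "\<And>x. m \<le> g x"
    and E: "\<And>R. integral {-R..R} (curve_density \<gamma>) \<le> E"
  shows "\<kappa> x = 0"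
proof -
  define k2 where "k2 x = \<kappa> x \<bullet> \<kappa> x" for x
  define J where "J x = N x \<bullet> N x + 1/4 * (k2 x)\<^sup>2" for x
  have k2_deriv: "(k2 has_real_derivative 2 * g x * (\<kappa> x \<bullet> N x)) (at x)" for x
    unfolding k2_def[abs_def]
    by (rule DERIV_cong[OF has_real_derivative_inner[OF \<kappa>_deriv \<kappa>_deriv]])
       (use \<kappa>_T[of x] in \<open>simp add: inner_diff_left inner_diff_right inner_commute algebra_simps\<close>)
  have N_N: "((\<lambda>x. N x \<bullet> N x) has_real_derivative - g x * k2 x * (\<kappa> x \<bullet> N x)) (at x)" for x
    by (rule DERIV_cong[OF has_real_derivative_inner[OF N_deriv N_deriv]])
       (use nabla_T[of \<kappa> x] in \<open>simp add: N2_eq V k2_def inner_diff_left inner_diff_right inner_commute algebra_simps\<close>)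
  have "(J has_real_derivative 0) (at x)" for x
    unfolding J_def[abs_def]
    by (rule DERIV_cong[OF DERIV_add[OF N_N DERIV_cmult[OF DERIV_power[OF k2_deriv]]]]) simp
  then have J_const: "J x = J 0" for x by (intro DERIV_isconst_all) auto
  define c where "c = J 0"
  have c: "N x \<bullet> N x + 1/4 * (k2 x)\<^sup>2 = c" for x using J_const[of x] by (simp add: J_def c_def)
  have c0: "0 \<le> c" by (simp add: c_def J_def)
  have "c = 0"
  proof (rule ccontr)
    assume "c \<noteq> 0"
    then have c_pos: "0 < c" using c0 by simp
    define K where "K = sqrt (4 * c)"
    have k2_le: "k2 x \<le> K" for x
    proof -
      have "(k2 x)\<^sup>2 \<le> 4 * c" using c[of x] inner_ge_zero[of "N x"] by linarith
      then show ?thesis unfolding K_def by (rule real_le_rsqrt)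
    qed
    define b where "b = (K + c) / 2"
    have bound: "\<bar>\<kappa> x \<bullet> N x\<bar> \<le> b" for x
    proof -
      have "N x \<bullet> N x \<le> c" using c[of x] zero_le_power2[of "k2 x"] by linarith
      then show ?thesis
        using abs_inner_le_mean_square[of "\<kappa> x" "N x"] k2_le[of x] by (simp add: b_def k2_def)
    qed
    have *: "2 * R * (m * c) \<le> 2 * b + 3/2 * K * E" if R: "0 \<le> R" for R
    proof -
      have upper: "((\<lambda>x. g x * (N x \<bullet> N x - 1/2 * (k2 x)\<^sup>2)) has_integral
          (\<kappa> R \<bullet> N R) - (\<kappa> (-R) \<bullet> N (-R))) {-R..R}"
        using R \<kappa>_N_deriv
        by (intro fundamental_theorem_of_calculus)
          (auto simp: has_real_derivative_iff_has_vector_derivative[symmetric] V k2_def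
            intro: has_field_derivative_at_within)
      have lower: "((\<lambda>x. m * c - 3/2 * K * curve_density \<gamma> x) has_integral
          (2 * R * (m * c) - 3/2 * K * integral {-R..R} (curve_density \<gamma>))) {-R..R}"
        using has_integral_const_real[of "m * c" "-R" R] R
        by (intro has_integral_diff has_integral_mult_right integrable_integral integrable_continuous_interval density_cont) 
           (simp add: algebra_simps)
      have le: "m * c - 3/2 * K * curve_density \<gamma> x \<le> g x * (N x \<bullet> N x - 1/2 * (k2 x)\<^sup>2)" for x
      proof -
        have "m * c \<le> g x * c" using m c0 by (intro mult_right_mono) auto
        moreover have "g x * (k2 x * k2 x) \<le> g x * (K * k2 x)"
          using k2_le[of x] by (intro mult_left_mono mult_right_mono) (auto simp: k2_def)
        moreover have N_N_eq: "N x \<bullet> N x = c - 1/4 * (k2 x)\<^sup>2" using c[of x] by simp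
        have "g x * (N x \<bullet> N x - 1/2 * (k2 x)\<^sup>2) = g x * c - 3/4 * (g x * (k2 x * k2 x))"
          unfolding N_N_eq by (simp add: power2_eq_square algebra_simps)
        moreover have "3/2 * K * curve_density \<gamma> x = 3/4 * (g x * (K * k2 x))"
          by (simp add: energy_density_eq k2_def)
        ultimately show ?thesis by linarith
      qed
      have "2 * R * (m * c) - 3/2 * K * integral {-R..R} (curve_density \<gamma>)
          \<le> (\<kappa> R \<bullet> N R) - (\<kappa> (-R) \<bullet> N (-R))"
        by (rule has_integral_le[OF lower upper le])
      moreover have "3/2 * K * integral {-R..R} (curve_density \<gamma>) \<le> 3/2 * K * E"
        using E[of R] c0 by (intro mult_left_mono) (auto simp: K_def)
      ultimately show ?thesis using bound[of R] bound[of "-R"] by linarith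
    qed
    obtain n :: nat where "2 * b + 3/2 * K * E < real n * (2 * (m * c))"
      using reals_Archimedean3[of "2 * (m * c)"] m c_pos by auto
    with *[of "real n"] show False by (simp add: mult.commute mult.left_commute)
  qed
  then show ?thesis using c[of x] inner_ge_zero[of "N x"]
    by (simp add: k2_def add_nonneg_eq_0_iff)
qed

text \<open>
  The tangent is a constant \<open>v\<close>, and \<open>\<phi> = \<langle>\<gamma> - \<gamma>(0), v\<rangle>\<close> is the arc length. It is onto because the speed is
  bounded below.
\<close>

lemma flat_straight_line:
  assumes flat: "\<And>x. \<kappa> x = 0" and m: "0 < m" "\<And>x. m \<le> g x"
  shows "straight_line \<gamma>"
proof -
  define v where "v = T 0"
  have "(T has_vector_derivative 0) (at x within UNIV)" for x using T_deriv'[of x] by (simp add: flat)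
  then have T: "T x = v" for x
    unfolding v_def using has_vector_derivative_zero_constant[of UNIV T] by (metis UNIV_I convex_UNIV)
  have v: "v \<bullet> v = 1" using T_unit[of 0] by (simp add: v_def)
  have u1: "u1 x = g x *\<^sub>R v" for x
    using T[of x] immersed[of x] by (auto simp: sgn_div_norm)
  define \<phi> where "\<phi> x = (\<gamma> x - \<gamma> 0) \<bullet> v" for x
  have \<gamma>1: "(\<gamma> has_vector_derivative u1 x) (at x)" for x
    using smooth_has_vector_derivative[OF smooth, of 0] by simp
  have bl: "bounded_linear (\<lambda>p. p \<bullet> v)" by (rule bounded_linear_inner_left)
  have "(D ^^ Suc k) \<phi> = (\<lambda>x. (D ^^ Suc k) \<gamma> x \<bullet> v)" for k
  proof (induction k)
    case 0
    have "(\<phi> has_vector_derivative (u1 x - 0) \<bullet> v) (at x)" for x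
      unfolding \<phi>_def[abs_def]
      by (intro bounded_linear.has_vector_derivative[OF bl] has_vector_derivative_diff \<gamma>1 has_vector_derivative_const)
    then show ?case by (auto intro!: D_eqI)
  next
    case (Suc k)
    have "D ((D ^^ Suc k) \<phi>) x = (D ^^ Suc (Suc k)) \<gamma> x \<bullet> v" for x
      unfolding Suc
      by (rule D_eqI[OF bounded_linear.has_vector_derivative[OF bl smooth_has_vector_derivative[OF smooth]]])
    then show ?case by (simp only: funpow.simps o_def fun_eq_iff) simp
  qed
  note D\<phi> = this
  have \<phi>1: "(\<phi> has_real_derivative g x) (at x)" for x
  proof -
    have "(\<phi> has_vector_derivative (u1 x - 0) \<bullet> v) (at x)"
      unfolding \<phi>_def[abs_def]
      by (intro bounded_linear.has_vector_derivative[OF bl] has_vector_derivative_diff \<gamma>1 has_vector_derivative_const)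
    moreover have "u1 x \<bullet> v = g x" by (subst u1) (simp add: v)
    ultimately show ?thesis by (simp add: has_real_derivative_iff_has_vector_derivative)
  qed
  have "smooth \<phi>"
    unfolding smooth_def
  proof (intro allI)
    fix k x
    show "(D ^^ k) \<phi> differentiable at x"
    proof (cases k)
      case 0
      then show ?thesis using \<phi>1 by (auto intro: differentiableI_vector simp: has_real_derivative_iff_has_vector_derivative)
    next
      case (Suc j)
      show ?thesis unfolding Suc D\<phi>
        by (rule differentiableI_vector[OF bounded_linear.has_vector_derivative[OF bl
              smooth_has_vector_derivative[OF smooth]]])
    qed
  qed
  moreover have "bij \<phi>"
  proof (rule bijI)
    have mono: "\<phi> x < \<phi> y" if "x < y" for x y
      by (rule DERIV_pos_imp_increasing[OF that]) (use \<phi>1 speed_pos in blast)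
    then show "inj \<phi>" by (metis injI linorder_neq_iff less_irrefl)
    have grow: "m * (y - x) \<le> \<phi> y - \<phi> x" if "x \<le> y" for x y
    proof -
      have "((\<lambda>x. \<phi> x - m * x) has_real_derivative g x - m) (at x)" for x
        by (auto intro!: derivative_eq_intros \<phi>1)
      then have "\<phi> x - m * x \<le> \<phi> y - m * y"
        using m by (intro DERIV_nonneg_imp_nondecreasing[OF that, of "\<lambda>x. \<phi> x - m * x"]) force
      then show ?thesis by (simp add: algebra_simps)
    qed
    have cont: "continuous_on S \<phi>" for S
      using \<phi>1 by (intro continuous_at_imp_continuous_on ballI DERIV_isCont)
    have "\<exists>x. \<phi> x = y" for y
    proof -
      have 0: "\<phi> 0 = 0" by (simp add: \<phi>_def)
      let ?r = "\<bar>y\<bar> / m"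
      have r: "0 \<le> ?r" "m * ?r = \<bar>y\<bar>" using m by auto
      have "\<bar>y\<bar> \<le> \<phi> ?r" "\<phi> (- ?r) \<le> - \<bar>y\<bar>"
        using grow[of 0 ?r] grow[of "- ?r" 0] r 0 by auto
      then have "\<phi> (- ?r) \<le> y" "y \<le> \<phi> ?r" by auto
      then show ?thesis
        using IVT'[of \<phi> "- ?r" y ?r] cont r by auto
    qed
    then show "surj \<phi>" by (metis surjI)
  qed
  moreover have "D \<phi> x \<noteq> 0" for x
    using D_eqI[OF \<phi>1[unfolded has_real_derivative_iff_has_vector_derivative]] immersed by simp
  ultimately have "reparametrization \<phi>" by (simp add: reparametrization_def)
  moreover have "\<gamma> = (\<lambda>s. \<gamma> 0 + s *\<^sub>R v) \<circ> \<phi>"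
  proof -
    have "((\<lambda>x. \<gamma> x - \<phi> x *\<^sub>R v) has_vector_derivative u1 x - (\<phi> x *\<^sub>R 0 + g x *\<^sub>R v)) (at x)" for x
      by (intro has_vector_derivative_diff has_vector_derivative_scaleR \<gamma>1 \<phi>1 has_vector_derivative_const)
    then have "((\<lambda>x. \<gamma> x - \<phi> x *\<^sub>R v) has_vector_derivative 0) (at x within UNIV)" for x
      using u1 by simp
    then have "\<gamma> x - \<phi> x *\<^sub>R v = \<gamma> 0 - \<phi> 0 *\<^sub>R v" for x
      using has_vector_derivative_zero_constant[of UNIV "\<lambda>x. \<gamma> x - \<phi> x *\<^sub>R v"] by (metis UNIV_I convex_UNIV)
    then show ?thesis by (auto simp: fun_eq_iff \<phi>_def algebra_simps)
  qed
  moreover have "v \<noteq> 0" using v by auto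
  ultimately show ?thesis unfolding straight_line_def by blast
qed

end

section \<open>Solitons\<close>

lemma maximal_solution_speed:
  assumes "maximal_solution W T \<gamma>0 \<gamma>"
  obtains m where "0 < m" "\<And>x. m \<le> norm (D \<gamma>0 x)" "immersed_curve \<gamma>0"
proof -
  let ?m = "INF x. norm (D \<gamma>0 x)"
  have m: "0 < ?m" using assms by (simp add: maximal_solution_def)
  have le: "?m \<le> norm (D \<gamma>0 x)" for x by (intro cINF_lower bdd_belowI[of _ 0]) auto
  have "smooth \<gamma>0" using assms by (simp add: maximal_solution_def Cdot_infty_def)
  then have "immersed_curve \<gamma>0" 
    using m le by (metis immersed_curve.intro less_le_not_le norm_zero)
  with m le show thesis by (rule that)
qed

text \<open>
  Some \<open>t < T\<close> has \<open>\<alpha> t < 1\<close>. There the energy is \<open>E / \<alpha> t\<close>, and it is at most \<open>E\<close>.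
\<close>

lemma shrinking_soliton_zero_energy:
  assumes sol: "shrinking_soliton free_elastic_flow T \<gamma>0 \<gamma>"
    and E: "(curve_density \<gamma>0 has_integral E) UNIV" "\<And>R. integral {-R..R} (curve_density \<gamma>0) \<le> E"
  shows "E \<le> 0"
proof -
  obtain \<alpha> where max: "maximal_solution free_elastic_flow T \<gamma>0 \<gamma>"
    and \<alpha>: "\<And>t. 0 \<le> t \<Longrightarrow> ereal t < T \<Longrightarrow> 0 < \<alpha> t" "((\<alpha> \<circ> real_of_ereal) \<longlongrightarrow> 0) (at_left T)"
    and iso: "\<And>t. 0 \<le> t \<Longrightarrow> ereal t < T \<Longrightarrow> isometric_curves (\<gamma> t) (\<lambda>x. \<alpha> t *\<^sub>R \<gamma>0 x)"
    using sol unfolding shrinking_soliton_def by blast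
  have T: "0 < T" using max unfolding maximal_solution_def by blast
  have "\<forall>\<^sub>F t in at_left T. (\<alpha> \<circ> real_of_ereal) t < 1" by (rule order_tendstoD(2)[OF \<alpha>(2)]) simp
  then obtain b where b: "b < T" "\<And>t. b < t \<Longrightarrow> t < T \<Longrightarrow> \<alpha> (real_of_ereal t) < 1"
    unfolding eventually_at_left[OF T] by auto
  obtain e where "max b 0 < e" "e < T" using dense[of "max b 0" T] b(1) T by auto
  then have e: "0 < e" "e < T" "\<alpha> (real_of_ereal e) < 1" using b(2)[of e] by auto
  define t where "t = real_of_ereal e"
  have et: "e = ereal t" unfolding t_def using e by (cases e) auto
  have t: "0 < t" "ereal t < T" "\<alpha> t < 1" using e unfolding et by auto
  then have \<alpha>_pos: "0 < \<alpha> t" by (intro \<alpha>) auto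
  interpret immersed_curve \<gamma>0 using max by (rule maximal_solution_speed)
  interpret flow: elastic_flow t \<gamma>0 \<gamma>
    using max t by (simp add: elastic_flow_def maximal_solution_def)
  have \<gamma>00: "\<gamma> 0 = \<gamma>0" using flow.solution by (auto simp: flow_solution_def)
  have bound: "integral {-M..M} (curve_density (\<gamma> t)) \<le> E - 0 / 2 * t" if "0 \<le> M" for M
    using t that by (intro flow.energy_inequality[where L = 0]) (auto simp: \<gamma>00 E)
  have "(curve_density (\<gamma> t) has_integral (1 / \<alpha> t) * E) UNIV"
    using t \<alpha>_pos by (intro isometric_has_integral[OF smooth immersed _ iso E(1)]) auto
  from has_integral_UNIV_le[OF this bound] have "(1 / \<alpha> t) * E \<le> E" by simp
  then have "E * (1 - \<alpha> t) \<le> 0" using \<alpha>_pos by (simp add: field_simps)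
  then show ?thesis using t by (simp add: mult_le_0_iff)
qed

text \<open>
  If the initial velocity were not zero at \<open>x0\<close>, then by continuity the dissipation near \<open>x0\<close> would be bounded
  below for a short time, and the energy would drop strictly, although it is the same at all times.
\<close>

lemma non_scaling_soliton_stationary:
  assumes sol: "non_scaling_soliton free_elastic_flow \<gamma>0 \<gamma>"
    and E: "(curve_density \<gamma>0 has_integral E) UNIV" "\<And>R. integral {-R..R} (curve_density \<gamma>0) \<le> E"
  shows "free_elastic_flow \<gamma>0 x0 = 0"
proof (rule ccontr)
  assume V0: "free_elastic_flow \<gamma>0 x0 \<noteq> 0"
  have max: "maximal_solution free_elastic_flow \<infinity> \<gamma>0 \<gamma>"
    and iso: "\<And>t. 0 \<le> t \<Longrightarrow> isometric_curves (\<gamma> t) \<gamma>0"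
    using sol by (auto simp: non_scaling_soliton_def)
  interpret immersed_curve \<gamma>0 using max by (rule maximal_solution_speed)
  interpret flow: elastic_flow 1 \<gamma>0 \<gamma>
    using max by (simp add: elastic_flow_def maximal_solution_def)
  have \<gamma>00: "\<gamma> 0 = \<gamma>0" using flow.solution by (auto simp: flow_solution_def)
  define w where "w = partial 1 1 0 \<gamma>"
  define L where "L = \<bar>x0\<bar> + 1"
  define J where "J t = integral {-L..L} (\<lambda>x. norm (D (\<gamma> t) x) * (w t x \<bullet> w t x))" for t
  have w0: "w 0 = V" using flow.w0_eq[of 0] by (simp add: w_def \<gamma>00)
  have "continuous_on {0..1} (\<lambda>t. integral (cbox (-L) L) (\<lambda>x. norm (D (\<gamma> t) x) * (w t x \<bullet> w t x)))"
  proof (rule integral_continuous_on_param)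
    let ?S = "{0..1} \<times> cbox (-L) L :: (real \<times> real) set"
    have c: "continuous_on ?S (\<lambda>p. D (\<gamma> (fst p)) (snd p))" "continuous_on ?S (\<lambda>p. w (fst p) (snd p))"
      using continuous_on_subset[OF flow.u_cont[of 1, unfolded flow.u_eq], of ?S]
        continuous_on_subset[OF flow.w_cont[of 0], of ?S]
      by (auto simp: split_def w_def)
    show "continuous_on ?S (\<lambda>(t, x). norm (D (\<gamma> t) x) * (w t x \<bullet> w t x))"
      unfolding split_def by (intro continuous_intros c)
  qed
  then have J_cont: "continuous_on {0..1} J" by (simp add: J_def[abs_def])
  have V_cont: "continuous_on S V" for S
    using flow.w_cont_x[of 0 S 0, folded w_def] by (simp only: w0) simp
  have u1_cont: "continuous_on S u1" for S
    by (intro continuous_at_imp_continuous_on ballI has_vector_derivative_continuous[OF u1_deriv])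
  have J0: "0 < J 0"
  proof -
    have "integral {-L..L} (\<lambda>x. g x * (V x \<bullet> V x)) \<noteq> 0"
      using V0 immersed[of x0]
      by (subst integral_eq_0_iff)
         (auto simp: L_def intro!: continuous_intros V_cont u1_cont bexI[of _ x0])
    moreover have "0 \<le> integral {-L..L} (\<lambda>x. g x * (V x \<bullet> V x))"
      by (intro integral_nonneg integrable_continuous_interval continuous_intros V_cont u1_cont) auto
    ultimately show ?thesis by (simp add: J_def w0 \<gamma>00)
  qed
  then obtain d where d: "0 < d" "\<And>t. t \<in> {0..1} \<Longrightarrow> \<bar>t\<bar> < d \<Longrightarrow> \<bar>J t - J 0\<bar> < J 0 / 2"
    using J_cont[unfolded continuous_on_iff, rule_format, of 0 "J 0 / 2"] by (auto simp: dist_real_def)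
  define s where "s = min 1 (d / 2)"
  have s: "0 < s" "s \<le> 1" "s < d" using d(1) by (auto simp: s_def)
  have bound: "integral {-M..M} (curve_density (\<gamma> s)) \<le> E - (J 0 / 2) / 2 * s" if "0 \<le> M" for M
  proof (rule flow.energy_inequality[where L = L])
    fix t assume "t \<in> {0..s}"
    then have "\<bar>J t - J 0\<bar> < J 0 / 2" using s by (intro d(2)) auto
    then have "J 0 / 2 \<le> J t" by linarith
    then show "J 0 / 2 \<le> integral {-L..L} (\<lambda>x. norm (D (\<gamma> t) x) * (partial 1 1 0 \<gamma> t x \<bullet> partial 1 1 0 \<gamma> t x))"
      unfolding J_def[of t] w_def .
  qed (use s J0 that E in \<open>auto simp: \<gamma>00 L_def\<close>)
  have "(curve_density (\<gamma> s) has_integral (1 / 1) * E) UNIV"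
    using s iso[of s] by (intro isometric_has_integral[OF smooth immersed _ _ E(1)]) auto
  from has_integral_UNIV_le[OF this bound] have "E \<le> E - (J 0 / 2) / 2 * s" by simp
  moreover have "0 < (J 0 / 2) / 2 * s" using J0 s by simp
  ultimately show False by linarith
qed

theorem corollary8p2:
  fixes \<gamma>0 :: "real \<Rightarrow> real ^ 'n"
  assumes "CARD('n) \<ge> 2"
    and "\<gamma>0 \<in> Cdot_infty"
    and "(\<exists>\<gamma>. non_scaling_soliton free_elastic_flow \<gamma>0 \<gamma>) \<or>
         (\<exists>T \<gamma>. shrinking_soliton free_elastic_flow T \<gamma>0 \<gamma>)"
    and "bending_energy \<gamma>0 < \<infinity>"
  shows "straight_line \<gamma>0"
proof -
  obtain T \<gamma> where "maximal_solution free_elastic_flow T \<gamma>0 \<gamma>"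
    using assms(3) by (auto simp: non_scaling_soliton_def shrinking_soliton_def)
  then obtain m where m: "0 < m" "\<And>x. m \<le> norm (D \<gamma>0 x)" and imm: "immersed_curve \<gamma>0"
    by (rule maximal_solution_speed) (rule that)
  interpret immersed_curve \<gamma>0 by (rule imm)
  obtain E where E: "(curve_density \<gamma>0 has_integral E) UNIV"
    "\<And>R. integral {-R..R} (curve_density \<gamma>0) \<le> E"
    using finite_bending_energy[OF assms(4)] by blast
  have "\<kappa> x = 0" for x
    using assms(3)
  proof (elim disjE exE)
    fix \<gamma> assume "non_scaling_soliton free_elastic_flow \<gamma>0 \<gamma>"
    from non_scaling_soliton_stationary[OF this E]
    show ?thesis by (rule free_elastica_flat[OF _ m E(2)])
  next
    fix T \<gamma> assume "shrinking_soliton free_elastic_flow T \<gamma>0 \<gamma>"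
    from shrinking_soliton_zero_energy[OF this E]
    show ?thesis using E(2) by (intro zero_energy_flat) (rule order_trans)
  qed
  then show ?thesis by (rule flat_straight_line[OF _ m])
qed

end
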